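(* Let $\nu_\alpha$ denote the free Gamma distribution with parameter $\alpha>0$. The measures $\frac1\alpha\nu_\alpha$ converge in moments to the measure $t^{-1}e^{-t}1_{(0,\infty)}(t)\,dt$ as $\alpha\downarrow0$. More precisely, for any $p$ in $\mathbb{N}=\{1,2,3,\ldots\}$, \[ \frac1\alpha\int_0^\infty t^p\,\nu_\alpha(dt)\longrightarrow\int_0^\infty t^{p-1}e^{-t}\,dt,\quad\text{as }\alpha\downarrow0. \]
   Context: Free Gamma distribution. For $\alpha>0$ let $\mu_\alpha$ be the classical Gamma distribution, $\mu_\alpha(B)=\frac1{\Gamma(\alpha)}\int_{B\cap[0,\infty)}t^{\alpha-1}e^{-t}\,dt$. A probability measure $\mu$ on $\mathbb{R}$ is ($*$-)infinitely divisible iff its characteristic function is $\hat\mu(u)=\exp\big[\mathrm{i}\eta u-\frac12au^2+\int_{\mathbb{R}}(e^{\mathrm{i}ut}-1-\mathrm{i}ut1_{[-1,1]}(t))\,\rho(dt)\big]$ with $\eta\in\mathbb{R}$, $a\ge0$ and $\rho$ a Lévy measure ($\rho(\{0\})=0$, $\int\min\{1,t^2\}\,\rho(dt)<\infty$); $(a,\rho,\eta)$ is unique and called the characteristic triplet of $\mu$. The Cauchy transform of $\mu$ is $G_\mu(z)=\int_{\mathbb{R}}\frac{1}{z-t}\,\mu(dt)$, $z\in\mathbb{C}\setminus\mathrm{supp}(\mu)$. The free cumulant transform is $\mathcal{C}_\mu(z)=zG_\mu^{\langle-1\rangle}(z)-1$, defined for $z\in\mathbb{C}^-$ with $1/z\in\Delta_{\eta,M}=\{w\in\mathbb{C}^+: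 |\mathrm{Re}\,w|<\eta\,\mathrm{Im}\,w,\ \mathrm{Im}\,w>M\}$ for suitable $\eta,M>0$, where the right inverse $G_\mu^{\langle-1\rangle}$ of $G_\mu$ is well-defined. $\mu$ is infinitely divisible with respect to free convolution $\boxplus$ iff $\mathcal{C}_\mu(z)=\eta z+az^2+\int_{\mathbb{R}}\big(\frac{1}{1-tz}-1-tz1_{[-1,1]}(t)\big)\,\rho(dt)$ for some $a\ge0$, $\eta\in\mathbb{R}$ and Lévy measure $\rho$; then $(a,\rho,\eta)$ is unique and called the free characteristic triplet of $\mu$. The Bercovici–Pata bijection $\Lambda$ sends the $*$-infinitely divisible law with characteristic triplet $(a,\rho,\eta)$ to the $\boxplus$-infinitely divisible law with free characteristic triplet $(a,\rho,\eta)$. The free Gamma distribution with parameter $\alpha$ is $\nu_\alpha=\Lambda(\mu_\alpha)$; it is supported in $[0,\infty)$. *)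

theory Defs
  imports "HOL-Probability.Probability"
begin

definition gamma_distribution :: "real \<Rightarrow> real measure" where
  "gamma_distribution \<alpha> =
     density lborel (\<lambda>t. ennreal (indicator {0..} t * (t powr (\<alpha> - 1) * exp (- t) / Gamma \<alpha>)))"

definition levy_measure :: "real measure \<Rightarrow> bool" where
  "levy_measure \<rho> \<longleftrightarrow> sets \<rho> = sets borel \<and> emeasure \<rho> {0} = 0 \<and>
     (\<integral>\<^sup>+ t. ennreal (min 1 (t\<^sup>2)) \<partial>\<rho>) < \<infinity>"

text \<open>
  A measure has a characteristic triplet iff it is infinitely divisible for classical
  convolution, so infinite divisibility is not introduced separately; likewise for the
  free characteristic triplet and free convolution below.
\<close>

definition characteristic_triplet ::
    "real measure \<Rightarrow> real \<Rightarrow> real measure \<Rightarrow> real \<Rightarrow> bool" where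
  "characteristic_triplet \<mu> a \<rho> \<eta> \<longleftrightarrow>
     real_distribution \<mu> \<and> 0 \<le> a \<and> levy_measure \<rho> \<and>
     (\<forall>u. char \<mu> u =
        exp (\<i> * of_real (\<eta> * u) - of_real (a * u\<^sup>2 / 2)
             + (CLINT t|\<rho>. iexp (u * t) - 1 - \<i> * of_real (u * t) * indicator {-1..1} t)))"

text \<open>
  Only meaningful off the support of \<open>\<mu>\<close>; below it is used on the upper half-plane.
\<close>

definition cauchy_transform :: "real measure \<Rightarrow> complex \<Rightarrow> complex" where
  "cauchy_transform \<mu> z = (CLINT t|\<mu>. 1 / (z - of_real t))"

definition truncated_cone :: "real \<Rightarrow> real \<Rightarrow> complex set" where
  "truncated_cone \<kappa> M = {w. 0 < Im w \<and> \<bar>Re w\<bar> < \<kappa> * Im w \<and> M < Im w}"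

text \<open>
  \<open>C\<close> is the free cumulant transform of \<open>\<mu>\<close> on the set of all \<open>z\<close> in the lower half-plane
  such that \<open>1 / z\<close> is in \<open>truncated_cone \<kappa> M\<close>.

  The Cauchy transform need not be injective on the upper half-plane and can have several
  analytic right inverses there: for the symmetric Bernoulli law on \<open>-1\<close> and \<open>1\<close>,
  the equation \<open>G w = z\<close> is \<open>w\<^sup>2 - w / z - 1 = 0\<close>, and both solutions \<open>w\<close> and \<open>- 1 / w\<close> may
  lie in the upper half-plane. The right inverse in the definition of the free cumulant
  transform is the one obtained by inverting \<open>G\<close> on a truncated cone
  \<open>truncated_cone \<kappa>' M'\<close> on which \<open>G\<close> is univalent. The choice of \<open>\<kappa>'\<close> and \<open>M'\<close> does not
  matter: two such inverses agree for \<open>1 / z\<close> in a smaller truncated cone, hence by analytic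
  continuation for \<open>1 / z\<close> in any truncated cone on which both are defined.
\<close>

definition free_cumulant_transform_on ::
    "real measure \<Rightarrow> real \<Rightarrow> real \<Rightarrow> (complex \<Rightarrow> complex) \<Rightarrow> bool" where
  "free_cumulant_transform_on \<mu> \<kappa> M C \<longleftrightarrow>
     (\<exists>\<kappa>' > 0. \<exists>M' > 0.
        inj_on (cauchy_transform \<mu>) (truncated_cone \<kappa>' M') \<and>
        (\<forall>z. Im z < 0 \<and> 1 / z \<in> truncated_cone \<kappa> M \<longrightarrow>
           z \<in> cauchy_transform \<mu> ` truncated_cone \<kappa>' M' \<and>
           C z = z * the_inv_into (truncated_cone \<kappa>' M') (cauchy_transform \<mu>) z - 1))"

definition free_characteristic_triplet ::
    "real measure \<Rightarrow> real \<Rightarrow> real measure \<Rightarrow> real \<Rightarrow> bool" where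
  "free_characteristic_triplet \<nu> a \<rho> \<eta> \<longleftrightarrow>
     real_distribution \<nu> \<and> 0 \<le> a \<and> levy_measure \<rho> \<and>
     (\<exists>\<kappa> > 0. \<exists>M > 0. free_cumulant_transform_on \<nu> \<kappa> M
        (\<lambda>z. of_real \<eta> * z + of_real a * z\<^sup>2
             + (CLINT t|\<rho>. 1 / (1 - of_real t * z) - 1 - of_real t * z * indicator {-1..1} t)))"

text \<open>
  The graph of the Bercovici--Pata bijection: \<open>bercovici_pata \<mu> \<nu>\<close> says that \<open>\<nu>\<close> is the
  image of \<open>\<mu>\<close>. Each infinitely divisible \<open>\<mu>\<close> has exactly one image \<open>\<nu>\<close>, by the theorem of
  Bercovici and Pata.
\<close>

definition bercovici_pata :: "real measure \<Rightarrow> real measure \<Rightarrow> bool" where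
  "bercovici_pata \<mu> \<nu> \<longleftrightarrow>
     (\<exists>a \<rho> \<eta>. characteristic_triplet \<mu> a \<rho> \<eta> \<and> free_characteristic_triplet \<nu> a \<rho> \<eta>)"

definition free_gamma :: "real \<Rightarrow> real measure \<Rightarrow> bool" where
  "free_gamma \<alpha> \<nu> \<longleftrightarrow> bercovici_pata (gamma_distribution \<alpha>) \<nu>"

end

theory Submission
  imports Defs "HOL-Complex_Analysis.Complex_Analysis" "HOL-Real_Asymp.Real_Asymp"
begin

text \<open>
  The proof rests on one functional equation. The classical cumulant transform of the Gamma law is
  \<open>- \<alpha> Ln (1 - \<i> u)\<close>, and the free cumulant transform with the same triplet is obtained from it by
  averaging over dilations of \<open>u\<close> with exponential weights, because
  \<open>1 / (1 - \<i> u t) = \<integral> exp (\<i> u x t) exp (- x) dx\<close>. So the free cumulant transform of \<open>\<nu>\<^sub>\<alpha>\<close> is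
  \<open>\<alpha> z \<integral> exp (- x) / (1 - z x) dx\<close> (\<open>free_cumulant_gamma\<close>). Consequently
  \<open>K z = 1 / z + \<alpha> \<integral> exp (- x) / (1 - z x) dx\<close> inverts the Cauchy transform \<open>G\<close> of \<open>\<nu>\<^sub>\<alpha>\<close> near \<open>0\<close>
  on the negative imaginary axis, and by analytic continuation \<open>K (G w) = w\<close> on the whole upper
  half-plane (\<open>free_gamma_K_inverts_cauchy_transform\<close>).

  Two consequences of this identity are used. Taking imaginary parts shows that \<open>Im (G (x + \<i> y))\<close>
  is \<open>O(y)\<close> for every \<open>x < 0\<close>, which forces \<open>\<nu>\<^sub>\<alpha>\<close> to have no mass on the negative half-line
  (\<open>free_gamma_nonneg\<close>). Letting \<open>w\<close> tend to \<open>- 1 / s\<close> then gives a real fixed-point equation: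
  with \<open>g s = \<integral> 1 / (1 + s t) \<nu>\<^sub>\<alpha>(dt)\<close> and \<open>E s = \<integral> exp (- x) / (1 + s x) dx\<close>, the function
  \<open>F = (1 - g) / (\<alpha> s)\<close>, which is the Stieltjes transform of \<open>t \<nu>\<^sub>\<alpha>(dt) / \<alpha>\<close>, satisfies
  \<open>F s = g s E (s g s)\<close> (\<open>stieltjes_equation\<close>). At \<open>\<alpha> = 0\<close> this reads \<open>g = 1\<close> and \<open>F = E\<close>, the
  Stieltjes transform of the exponential law; so the claim is that the Taylor coefficients of \<open>F\<close>
  at \<open>s = 0\<close> are continuous in \<open>\<alpha>\<close> at \<open>\<alpha> = 0\<close>.

  The coefficients are extracted with the difference operator \<open>D h = (h(0+) - h) / s\<close>. It maps the
  transform \<open>\<integral> t^n / (1 + s t) M(dt)\<close> of a measure \<open>M\<close> to the one with \<open>n + 1\<close> in place of \<open>n\<close>, so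
  the limits at \<open>0\<close> of its iterates are the moments of \<open>M\<close>, and the existence of these limits
  gives the existence of the moments by monotone convergence. Families on which all iterates up to
  a given order have limits that are continuous at \<open>\<alpha> = 0\<close> are closed under products, and the
  factor \<open>s\<close> in \<open>g = 1 - \<alpha> s F\<close> makes the fixed-point equation raise the order of \<open>F\<close> by one
  (\<open>expandable_fixed_point\<close>). Hence \<open>F\<close> has expansions of all orders.
\<close>

section \<open>Quadratic remainders and bounded integrands\<close>

lemma eventually_at_right_0I: "(\<And>s::real. 0 < s \<Longrightarrow> P s) \<Longrightarrow> eventually P (at_right 0)"
  using eventually_at_right_less[of "0::real"] by (rule eventually_mono)

text \<open>
  Parameter integrals are differentiated below, and distribution functions shown to be constant,
  by an explicit quadratic bound on the remainder.
\<close>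

lemma has_derivative_of_quadratic_remainder:
  fixes F :: "'a :: real_normed_vector \<Rightarrow> 'b :: real_normed_vector"
  assumes L: "bounded_linear L" and \<delta>: "0 < \<delta>"
    and rem: "\<And>h. norm h < \<delta> \<Longrightarrow> norm (F (x + h) - F x - L h) \<le> C * (norm h)\<^sup>2"
  shows "(F has_derivative L) (at x)"
  unfolding has_derivative_at
proof (intro conjI L)
  show "((\<lambda>h. norm (F (x + h) - F x - L h) / norm h) \<longlongrightarrow> 0) (at 0)"
  proof (rule tendsto_sandwich[OF _ _ tendsto_const])
    have "((\<lambda>h::'a. C * norm h) \<longlongrightarrow> C * norm (0::'a)) (at 0)"
      by (intro tendsto_intros)
    then show "((\<lambda>h::'a. C * norm h) \<longlongrightarrow> 0) (at 0)" by simp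
    have "eventually (\<lambda>h::'a. norm h < \<delta>) (at 0)"
      using \<delta> by (auto simp: eventually_at dist_norm)
    then show "eventually (\<lambda>h. norm (F (x + h) - F x - L h) / norm h \<le> C * norm h) (at 0)"
    proof eventually_elim
      case (elim h)
      then show ?case using rem[of h] by (cases "h = 0") (auto simp: divide_le_eq power2_eq_square mult.assoc)
    qed
  qed (auto intro!: always_eventually)
qed

lemma integrable_bounded_inverse:
  fixes f :: "real \<Rightarrow> complex"
  assumes "finite_measure M" and [measurable_cong]: "sets M = sets borel"
    and [measurable]: "f \<in> borel_measurable borel"
    and "0 < \<delta>" "AE t in M. \<delta> \<le> cmod (f t)"
  shows "integrable M (\<lambda>t. 1 / f t)"
proof (rule finite_measure.integrable_const_bound[OF assms(1), where B = "1 / \<delta>"])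
  show "AE t in M. norm (1 / f t) \<le> 1 / \<delta>"
    using assms(5) by eventually_elim (use \<open>0 < \<delta>\<close> in \<open>auto simp: norm_divide intro!: divide_left_mono mult_pos_pos\<close>)
qed measurable

section \<open>The exponential law\<close>

definition exp_law :: "real measure" where
  "exp_law = density lborel (exponential_density 1)"

lemma prob_space_exp_law: "prob_space exp_law"
  unfolding exp_law_def by (rule prob_space_exponential_density) simp

interpretation exp_law: prob_space exp_law
  by (rule prob_space_exp_law)

lemma sets_exp_law [simp, measurable_cong]: "sets exp_law = sets borel"
  by (simp add: exp_law_def)

lemma space_exp_law [simp]: "space exp_law = UNIV"
  by (simp add: exp_law_def)

lemma exp_law_pos: "AE t in exp_law. 0 < t"
proof -
  have "AE t in lborel. t \<noteq> (0::real)"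
    by (rule AE_lborel_singleton)
  then show ?thesis
    unfolding exp_law_def
    by (subst AE_density) (auto simp: exponential_density_def elim!: eventually_mono)
qed

lemma
  fixes f :: "real \<Rightarrow> 'a :: {banach, second_countable_topology}"
  assumes [measurable]: "f \<in> borel_measurable borel"
  shows integrable_exp_law_iff:
      "integrable exp_law f \<longleftrightarrow> set_integrable lborel {0<..} (\<lambda>t. exp (- t) *\<^sub>R f t)" (is ?A)
    and integral_exp_law_eq:
      "integral\<^sup>L exp_law f = (LINT t:{0<..}|lborel. exp (- t) *\<^sub>R f t)" (is ?B)
proof -
  have ae: "AE t in lborel. exponential_density 1 t *\<^sub>R f t
      = indicator {0<..} t *\<^sub>R exp (- t) *\<^sub>R f t"
    using AE_lborel_singleton[of "0::real"]
    by eventually_elim (auto simp: exponential_density_def indicator_def)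
  have "integrable exp_law f \<longleftrightarrow> integrable lborel (\<lambda>t. exponential_density 1 t *\<^sub>R f t)"
    unfolding exp_law_def by (rule integrable_density) (auto simp: exponential_density_nonneg)
  also have "\<dots> \<longleftrightarrow> set_integrable lborel {0<..} (\<lambda>t. exp (- t) *\<^sub>R f t)"
    unfolding set_integrable_def by (rule integrable_cong_AE[OF _ _ ae]) measurable
  finally show ?A .
  have "integral\<^sup>L exp_law f = (LINT t|lborel. exponential_density 1 t *\<^sub>R f t)"
    unfolding exp_law_def by (rule integral_density) (auto simp: exponential_density_nonneg)
  also have "\<dots> = (LINT t:{0<..}|lborel. exp (- t) *\<^sub>R f t)"
    unfolding set_lebesgue_integral_def by (rule integral_cong_AE[OF _ _ ae]) measurable
  finally show ?B .
qed

text \<open>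
  The derivative of \<open>exp (- x) H x\<close> is \<open>exp (- x) (H' x - H x)\<close>, so the difference of the two
  expectations is a boundary term. The derivative is only assumed for positive arguments because
  the derivative of \<open>x powr b\<close> with \<open>b < 1\<close> is singular at \<open>0\<close>.
\<close>

lemma exp_law_by_parts:
  fixes H H' :: "real \<Rightarrow> complex"
  assumes deriv: "\<And>x. 0 < x \<Longrightarrow> (H has_vector_derivative H' x) (at x)"
    and cont: "\<And>x. 0 < x \<Longrightarrow> isCont H' x"
    and int: "integrable exp_law H" "integrable exp_law H'"
    and H0: "(H \<longlongrightarrow> h0) (at_right 0)"
    and Hinf: "((\<lambda>x. exp (- x) *\<^sub>R H x) \<longlongrightarrow> 0) at_top"
  shows "integral\<^sup>L exp_law H = h0 + integral\<^sup>L exp_law H'"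
proof -
  define f where "f x = exp (- x) *\<^sub>R (H' x - H x)" for x
  have meas [measurable]: "H \<in> borel_measurable borel" "H' \<in> borel_measurable borel"
    using int[THEN borel_measurable_integrable] by (simp_all add: measurable_cong_sets[OF sets_exp_law refl])
  have diff: "integrable exp_law (\<lambda>x. H' x - H x)"
    using int by simp
  have "(LBINT x=0..\<infinity>. f x) = 0 - h0"
  proof (rule interval_integral_FTC_integrable[where F = "\<lambda>x. exp (- x) *\<^sub>R H x"])
    fix x :: real assume "0 < ereal x" "ereal x < \<infinity>"
    then have x: "0 < x" by simp
    show "((\<lambda>x. exp (- x) *\<^sub>R H x) has_vector_derivative f x) (at x)"
      unfolding f_def using deriv[OF x]
      by (auto intro!: derivative_eq_intros simp: algebra_simps)
    have "isCont H x"
      using deriv[OF x] has_vector_derivative_continuous by blast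
    then show "isCont f x"
      unfolding f_def using cont[OF x] by (intro continuous_intros)
  next
    show "set_integrable lborel (einterval 0 \<infinity>) f"
      using diff unfolding integrable_exp_law_iff[OF borel_measurable_diff[OF meas(2,1)]]
      by (simp add: f_def[abs_def] zero_ereal_def einterval_eq_Ici)
    have "((\<lambda>x. exp (- x) *\<^sub>R H x) \<longlongrightarrow> exp (- 0) *\<^sub>R h0) (at_right 0)"
      by (intro tendsto_intros H0)
    then show "(((\<lambda>x. exp (- x) *\<^sub>R H x) \<circ> real_of_ereal) \<longlongrightarrow> h0) (at_right 0)"
      by (simp add: zero_ereal_def ereal_tendsto_simps)
    show "(((\<lambda>x. exp (- x) *\<^sub>R H x) \<circ> real_of_ereal) \<longlongrightarrow> 0) (at_left \<infinity>)"
      using Hinf by (simp add: ereal_tendsto_simps)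
  qed simp
  also have "(LBINT x=0..\<infinity>. f x) = integral\<^sup>L exp_law (\<lambda>x. H' x - H x)"
    by (subst integral_exp_law_eq)
       (simp_all add: f_def[abs_def] interval_lebesgue_integral_0_infty)
  also have "\<dots> = integral\<^sup>L exp_law H' - integral\<^sup>L exp_law H"
    using int by simp
  finally show ?thesis
    by (simp add: algebra_simps)
qed

lemma integrable_exp_law_powr:
  assumes "-1 < b"
  shows "integrable exp_law (\<lambda>t. t powr b)"
    and "(LINT t|exp_law. t powr b) = Gamma (b + 1)"
proof -
  have nn: "(\<integral>\<^sup>+ t. ennreal (t powr b) \<partial>exp_law) = ennreal (Gamma (b + 1))"
  proof -
    have "(\<integral>\<^sup>+ t. ennreal (t powr b) \<partial>exp_law)
        = (\<integral>\<^sup>+ t. ennreal (exponential_density 1 t) * ennreal (t powr b) \<partial>lborel)"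
      unfolding exp_law_def by (rule nn_integral_density) auto
    also have "\<dots> = (\<integral>\<^sup>+ t. ennreal (indicator {0..} t * t powr (b + 1 - 1) / exp t) \<partial>lborel)"
      by (intro nn_integral_cong)
         (auto simp: exponential_density_def indicator_def exp_minus divide_inverse
               ennreal_mult'[symmetric] mult.commute)
    also have "\<dots> = ennreal (Gamma (b + 1))"
      using Gamma_conv_nn_integral_real[of "b + 1"] assms by simp
    finally show ?thesis .
  qed
  show int: "integrable exp_law (\<lambda>t. t powr b)"
    by (rule integrableI_nn_integral_finite[OF _ _ nn]) auto
  show "(LINT t|exp_law. t powr b) = Gamma (b + 1)"
    using nn assms by (subst integral_eq_nn_integral) (auto intro!: Gamma_real_nonneg)
qed

lemma AE_exp_law_powr_eq_power: "AE t in exp_law. t powr real n = t ^ n"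
  using exp_law_pos by eventually_elim (simp add: powr_realpow)

lemma integrable_exp_law_power: "integrable exp_law (\<lambda>t. t ^ n)"
  using integrable_exp_law_powr(1)[of "real n"]
  by (rule integrable_cong_AE_imp) (use AE_exp_law_powr_eq_power in \<open>auto simp: eq_commute\<close>)

lemma integral_exp_law_power: "(LINT x|exp_law. x ^ n) = fact n"
proof -
  have "(LINT x|exp_law. x ^ n) = (LINT x|exp_law. x powr real n)"
    by (rule integral_cong_AE) (use AE_exp_law_powr_eq_power in \<open>auto simp: eq_commute\<close>)
  also have "\<dots> = Gamma (real n + 1)" by (rule integrable_exp_law_powr) simp
  also have "\<dots> = fact n" using Gamma_fact[of n, where ?'a = real] by (simp add: add.commute)
  finally show ?thesis .
qed

text \<open>
  All Gamma integrals are referred to the exponential law, so that a single integration by parts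
  formula serves for every \<open>\<alpha>\<close>.
\<close>

lemma integral_gamma_distribution:
  fixes f :: "real \<Rightarrow> complex"
  assumes \<alpha>: "0 < \<alpha>" and [measurable]: "f \<in> borel_measurable borel"
  shows "integral\<^sup>L (gamma_distribution \<alpha>) f
    = (LINT t|exp_law. t powr (\<alpha> - 1) *\<^sub>R f t) / of_real (Gamma \<alpha>)"
proof -
  have "integral\<^sup>L (gamma_distribution \<alpha>) f
      = (LINT t|lborel. (indicator {0..} t * (t powr (\<alpha> - 1) * exp (- t) / Gamma \<alpha>)) *\<^sub>R f t)"
    unfolding gamma_distribution_def
    by (rule integral_density) (use \<alpha> in \<open>auto intro!: AE_I2 mult_nonneg_nonneg divide_nonneg_nonneg Gamma_real_nonneg\<close>)
  also have "\<dots> = (LINT t|lborel. (indicator {0<..} t *\<^sub>R exp (- t) *\<^sub>R (t powr (\<alpha> - 1) *\<^sub>R f t)) / of_real (Gamma \<alpha>))"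
  proof (rule integral_cong_AE)
    show "AE t in lborel. (indicator {0..} t * (t powr (\<alpha> - 1) * exp (- t) / Gamma \<alpha>)) *\<^sub>R f t
        = (indicator {0<..} t *\<^sub>R exp (- t) *\<^sub>R (t powr (\<alpha> - 1) *\<^sub>R f t)) / of_real (Gamma \<alpha>)"
      using AE_lborel_singleton[of "0::real"]
      by eventually_elim (auto simp: indicator_def scaleR_conv_of_real)
  qed measurable
  also have "\<dots> = (LINT t|exp_law. t powr (\<alpha> - 1) *\<^sub>R f t) / of_real (Gamma \<alpha>)"
    by (subst integral_exp_law_eq) (simp_all add: set_lebesgue_integral_def)
  finally show ?thesis .
qed

section \<open>Free cumulants of the free Gamma law\<close>

lemma one_minus_i_not_nonpos: "1 - \<i> * of_real u \<notin> \<real>\<^sub>\<le>\<^sub>0"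
  by (auto simp: complex_nonpos_Reals_iff)

lemma one_minus_i_nz: "1 - \<i> * complex_of_real u \<noteq> 0"
  by (metis one_minus_i_not_nonpos nonpos_Reals_zero_I)

lemma has_vector_derivative_iexp:
  "((\<lambda>t. iexp (u * t)) has_vector_derivative \<i> * of_real u * iexp (u * t)) (at t)"
proof -
  have "((\<lambda>t. exp (\<i> * of_real u * of_real t)) has_vector_derivative
      exp (\<i> * of_real u * of_real t) * (\<i> * of_real u)) (at t)"
    by (rule has_vector_derivative_real_field) (auto intro!: derivative_eq_intros)
  then show ?thesis by (simp add: ac_simps)
qed

text \<open>
  Integration by parts applied to \<open>t powr b * iexp (u * t)\<close>; it expresses the derivative of the
  characteristic function of a Gamma law through the function itself.
\<close>

lemma exp_law_powr_iexp:
  assumes b: "0 < b"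
  shows "(1 - \<i> * of_real u) * (LINT t|exp_law. t powr b *\<^sub>R iexp (u * t))
    = of_real b * (LINT t|exp_law. t powr (b - 1) *\<^sub>R iexp (u * t))"
proof -
  have int: "integrable exp_law (\<lambda>t. t powr c *\<^sub>R iexp (u * t))" if "-1 < c" for c
    by (rule Bochner_Integration.integrable_bound[OF integrable_exp_law_powr(1)[OF that]]) auto
  have ints: "integrable exp_law (\<lambda>t. t powr b *\<^sub>R iexp (u * t))"
    "integrable exp_law (\<lambda>t. t powr (b - 1) *\<^sub>R iexp (u * t))"
    using b by (intro int; simp)+
  let ?H = "\<lambda>t. t powr b *\<^sub>R iexp (u * t)"
  let ?H' = "\<lambda>t. of_real b * (t powr (b - 1) *\<^sub>R iexp (u * t)) + \<i> * of_real u * (t powr b *\<^sub>R iexp (u * t))"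
  have "integral\<^sup>L exp_law ?H = 0 + integral\<^sup>L exp_law ?H'"
  proof (rule exp_law_by_parts)
    fix x :: real assume x: "0 < x"
    have "((\<lambda>t. t powr b) has_field_derivative b * x powr (b - 1)) (at x)"
      using x by (auto intro!: derivative_eq_intros)
    from has_vector_derivative_scaleR[OF this has_vector_derivative_iexp[of u x]]
    show "(?H has_vector_derivative ?H' x) (at x)"
      by (rule has_vector_derivative_eq_rhs) (simp add: scaleR_conv_of_real mult.assoc add.commute)
    show "isCont ?H' x"
      using x by (intro continuous_intros) auto
  next
    show "integrable exp_law ?H" using ints b by simp
    show "integrable exp_law ?H'"
      using ints b by (intro Bochner_Integration.integrable_add integrable_mult_right) auto
    have lim0: "((\<lambda>t. t powr b) \<longlongrightarrow> 0) (at_right 0)"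
      using b by real_asymp
    show "(?H \<longlongrightarrow> 0) (at_right 0)"
      by (rule Lim_null_comparison[OF _ lim0]) (simp add: always_eventually)
    have lim: "((\<lambda>x::real. exp (- x) * x powr b) \<longlongrightarrow> 0) at_top"
      using b by real_asymp
    show "((\<lambda>x. exp (- x) *\<^sub>R ?H x) \<longlongrightarrow> 0) at_top"
      by (rule Lim_null_comparison[OF _ lim]) (simp add: always_eventually)
  qed
  also have "\<dots> = of_real b * (LINT t|exp_law. t powr (b - 1) *\<^sub>R iexp (u * t))
      + \<i> * of_real u * integral\<^sup>L exp_law ?H"
    by (subst Bochner_Integration.integral_add[OF integrable_mult_right[OF ints(2)]
          integrable_mult_right[OF ints(1)]]) (simp only: integral_mult_right_zero add_0)
  finally show ?thesis by (simp add: algebra_simps)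
qed

lemma norm_iexp_remainder: "cmod (iexp x - 1 - \<i> * of_real x) \<le> x\<^sup>2 / 2"
  using iexp_approx1[of x 1] by (simp add: numeral_2_eq_2 diff_diff_eq)

lemma has_vector_derivative_exp_law_powr_iexp:
  assumes b: "0 < b"
  shows "((\<lambda>u. LINT t|exp_law. t powr (b - 1) *\<^sub>R iexp (u * t)) has_vector_derivative
    \<i> * (LINT t|exp_law. t powr b *\<^sub>R iexp (u * t))) (at u)"
  unfolding has_vector_derivative_def
proof (rule has_derivative_of_quadratic_remainder[where \<delta> = 1])
  have int: "integrable exp_law (\<lambda>t. t powr c *\<^sub>R iexp (v * t))" if "-1 < c" for c v
    by (rule Bochner_Integration.integrable_bound[OF integrable_exp_law_powr(1)[OF that]]) auto
  fix h :: real
  let ?F = "\<lambda>u. LINT t|exp_law. t powr (b - 1) *\<^sub>R iexp (u * t)"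
  let ?D = "\<i> * (LINT t|exp_law. t powr b *\<^sub>R iexp (u * t))"
  let ?r = "\<lambda>t. t powr (b - 1) *\<^sub>R iexp ((u + h) * t) - t powr (b - 1) *\<^sub>R iexp (u * t)
      - h *\<^sub>R (\<i> * (t powr b *\<^sub>R iexp (u * t)))"
  have i1: "integrable exp_law (\<lambda>t. t powr (b - 1) *\<^sub>R iexp ((u + h) * t))"
    and i2: "integrable exp_law (\<lambda>t. t powr (b - 1) *\<^sub>R iexp (u * t))"
    and i3: "integrable exp_law (\<lambda>t. h *\<^sub>R (\<i> * (t powr b *\<^sub>R iexp (u * t))))"
    using b by (intro integrable_scaleR_right integrable_mult_right int; simp)+
  have eq: "?F (u + h) - ?F u - h *\<^sub>R ?D = integral\<^sup>L exp_law ?r"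
    by (subst Bochner_Integration.integral_diff[OF Bochner_Integration.integrable_diff[OF i1 i2] i3],
        subst Bochner_Integration.integral_diff[OF i1 i2])
       (simp only: integral_scaleR_right integral_mult_right_zero)
  have bound: "AE t in exp_law. cmod (?r t) \<le> h\<^sup>2 / 2 * t powr (b + 1)"
    using exp_law_pos
  proof eventually_elim
    case (elim t)
    have p: "t powr b = t powr (b - 1) * t" "t powr (b + 1) = t powr (b - 1) * t\<^sup>2"
      using elim powr_add[of t "b - 1" 1] powr_add[of t "b - 1" 2] by (simp_all add: add.commute)
    have "?r t = of_real (t powr (b - 1)) * iexp (u * t) * (iexp (h * t) - 1 - \<i> * of_real (h * t))"
      unfolding p by (simp add: scaleR_conv_of_real algebra_simps exp_add)
    then have "cmod (?r t) = t powr (b - 1) * cmod (iexp (h * t) - 1 - \<i> * of_real (h * t))"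
      by (simp add: norm_mult del: of_real_mult)
    also have "\<dots> \<le> t powr (b - 1) * ((h * t)\<^sup>2 / 2)"
      by (intro mult_left_mono norm_iexp_remainder) simp
    also have "\<dots> = h\<^sup>2 / 2 * t powr (b + 1)"
      unfolding p by (simp add: power_mult_distrib)
    finally show ?case .
  qed
  have "norm (integral\<^sup>L exp_law ?r) \<le> (LINT t|exp_law. cmod (?r t))"
    by (rule integral_norm_bound)
  also have "\<dots> \<le> (LINT t|exp_law. h\<^sup>2 / 2 * t powr (b + 1))"
    by (rule integral_mono_AE[OF integrable_norm[OF Bochner_Integration.integrable_diff[OF
            Bochner_Integration.integrable_diff[OF i1 i2] i3]] _ bound])
       (intro integrable_mult_right integrable_exp_law_powr, use b in simp)
  also have "\<dots> = (LINT t|exp_law. t powr (b + 1)) / 2 * (norm h)\<^sup>2"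
    by simp
  finally show "norm (?F (u + h) - ?F u - h *\<^sub>R ?D) \<le> (LINT t|exp_law. t powr (b + 1)) / 2 * (norm h)\<^sup>2"
    unfolding eq .
qed (auto intro: bounded_linear_scaleR_left)

text \<open>
  By \<open>exp_law_powr_iexp\<close> the characteristic function solves \<open>F' = \<i> \<alpha> / (1 - \<i> u) F\<close>, and so does
  the right-hand side; hence their quotient is constant.
\<close>

lemma char_gamma_distribution:
  assumes \<alpha>: "0 < \<alpha>"
  shows "char (gamma_distribution \<alpha>) u = exp (- of_real \<alpha> * Ln (1 - \<i> * of_real u))"
proof -
  define F where "F u = (LINT t|exp_law. t powr (\<alpha> - 1) *\<^sub>R iexp (u * t))" for u
  define L where "L u = exp (of_real \<alpha> * Ln (1 - \<i> * of_real u))" for u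
  have dF: "(F has_vector_derivative \<i> * of_real \<alpha> / (1 - \<i> * of_real u) * F u) (at u)" for u
  proof -
    have "(LINT t|exp_law. t powr \<alpha> *\<^sub>R iexp (u * t)) = of_real \<alpha> / (1 - \<i> * of_real u) * F u"
      using exp_law_powr_iexp[OF \<alpha>, of u] one_minus_i_nz[of u] by (simp add: F_def field_simps)
    then show ?thesis
      using has_vector_derivative_exp_law_powr_iexp[OF \<alpha>, of u]
      by (simp add: F_def[abs_def] mult.assoc)
  qed
  have dL: "(L has_vector_derivative - \<i> * of_real \<alpha> / (1 - \<i> * of_real u) * L u) (at u)" for u
  proof -
    have "((\<lambda>z. exp (of_real \<alpha> * Ln (1 - \<i> * z))) has_field_derivative
       - \<i> * of_real \<alpha> / (1 - \<i> * of_real u) * L u) (at (of_real u))"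
      using one_minus_i_not_nonpos[of u] one_minus_i_nz[of u]
      by (auto intro!: derivative_eq_intros simp: L_def field_simps)
    from has_vector_derivative_real_field[OF this] show ?thesis by (simp add: L_def[abs_def])
  qed
  have "((\<lambda>u. F u * L u) has_vector_derivative 0) (at u within UNIV)" for u
    using has_vector_derivative_mult[OF dF[of u] dL[of u]] by simp
  then obtain c where c: "\<And>u. F u * L u = c"
    using has_vector_derivative_zero_constant[of UNIV "\<lambda>u. F u * L u"] by auto
  have "F 0 = of_real (Gamma \<alpha>)"
    unfolding F_def using integrable_exp_law_powr(2)[of "\<alpha> - 1"] \<alpha>
    by (simp add: scaleR_conv_of_real)
  moreover have "L 0 = 1" by (simp add: L_def)
  ultimately have "F u * L u = of_real (Gamma \<alpha>)" using c[of 0] c[of u] by simp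
  moreover have "L u * exp (- of_real \<alpha> * Ln (1 - \<i> * of_real u)) = 1"
    unfolding L_def by (simp add: exp_add[symmetric])
  ultimately have "F u = of_real (Gamma \<alpha>) * exp (- of_real \<alpha> * Ln (1 - \<i> * of_real u))"
    by (metis mult.assoc mult.right_neutral)
  moreover have "char (gamma_distribution \<alpha>) u = F u / of_real (Gamma \<alpha>)"
    unfolding char_def F_def using \<alpha> by (subst integral_gamma_distribution) auto
  moreover have "Gamma \<alpha> \<noteq> 0" using Gamma_real_pos[OF \<alpha>] by simp
  ultimately show ?thesis by simp
qed

text \<open>
  The integrand of the classical representation, as a function of the frequency \<open>u\<close> and the jump
  \<open>t\<close>.
\<close>

definition levy_kernel :: "real \<Rightarrow> real \<Rightarrow> complex" where
  "levy_kernel u t = iexp (u * t) - 1 - \<i> * of_real (u * t) * indicator {-1..1} t"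

text \<open>
  The quadratic growth in \<open>u\<close> makes the kernel integrable against the exponential law, the factor
  \<open>min 1 (t\<^sup>2)\<close> makes it integrable against every Levy measure.
\<close>

lemma norm_levy_kernel: "cmod (levy_kernel u t) \<le> (2 + u\<^sup>2) * min 1 (t\<^sup>2)"
proof (cases "\<bar>t\<bar> \<le> 1")
  case True
  then have t: "t\<^sup>2 \<le> 1" "t \<in> {-1..1}" by (auto simp: abs_square_le_1)
  have "cmod (levy_kernel u t) \<le> (u * t)\<^sup>2 / 2"
    using norm_iexp_remainder[of "u * t"] t by (simp add: levy_kernel_def)
  also have "\<dots> \<le> (2 + u\<^sup>2) * t\<^sup>2"
    by (simp add: power_mult_distrib algebra_simps)
  finally show ?thesis using t by (simp add: min_def)
next
  case False
  then have t: "1 \<le> t\<^sup>2" "t \<notin> {-1..1}" using abs_square_le_1[of t] by auto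
  have "cmod (levy_kernel u t) \<le> cmod (iexp (u * t)) + 1"
    using norm_triangle_ineq4[of "iexp (u * t)" 1] t by (simp add: levy_kernel_def)
  also have "\<dots> \<le> 2 + u\<^sup>2" by simp
  finally show ?thesis using t by (simp add: min_def)
qed

lemma borel_measurable_levy_kernel [measurable]: "levy_kernel u \<in> borel_measurable borel"
  unfolding levy_kernel_def by measurable

lemma levy_measure_integrable:
  assumes "levy_measure \<rho>"
  shows "integrable \<rho> (\<lambda>t. min 1 (t\<^sup>2))"
proof -
  have [measurable_cong]: "sets \<rho> = sets borel" using assms by (simp add: levy_measure_def)
  show ?thesis
    by (rule integrableI_nonneg) (use assms in \<open>auto simp: levy_measure_def\<close>)
qed

text \<open>
  Away from \<open>0\<close> this is Markov's inequality for \<open>min 1 (t\<^sup>2)\<close>; the point \<open>0\<close> has no mass. This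
  justifies Fubini's theorem for the exponential average of the classical exponent.
\<close>

lemma sigma_finite_levy_measure:
  assumes \<rho>: "levy_measure \<rho>"
  shows "sigma_finite_measure \<rho>"
proof
  have [measurable_cong]: "sets \<rho> = sets borel" and null: "emeasure \<rho> {0} = 0"
    using \<rho> by (simp_all add: levy_measure_def)
  have space: "space \<rho> = UNIV" using sets_eq_imp_space_eq[of \<rho> borel] \<rho> by (simp add: levy_measure_def)
  define A where "A n = {t::real. 1 / real (Suc n) \<le> min 1 (t\<^sup>2)}" for n
  have fin: "emeasure \<rho> (A n) < \<infinity>" for n
  proof -
    have "emeasure \<rho> {t \<in> space \<rho>. 1 / real (Suc n) \<le> min 1 (t\<^sup>2)}
        \<le> ennreal (1 / (1 / real (Suc n)) * (LINT t|\<rho>. min 1 (t\<^sup>2)))"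
      by (rule integral_Markov_inequality[OF levy_measure_integrable[OF \<rho>]]) auto
    then show ?thesis by (simp add: A_def space le_less_trans)
  qed
  have cover: "t = 0 \<or> (\<exists>n. t \<in> A n)" for t
  proof (cases "t = 0")
    case False
    then have "0 < min 1 (t\<^sup>2)" by simp
    then obtain n where "inverse (real (Suc n)) < min 1 (t\<^sup>2)" using reals_Archimedean by blast
    then have "t \<in> A n" by (simp add: A_def inverse_eq_divide)
    then show ?thesis by blast
  qed simp
  have [measurable]: "A n \<in> sets \<rho>" for n
    unfolding A_def using \<rho> by (simp add: levy_measure_def)
  show "\<exists>C. countable C \<and> C \<subseteq> sets \<rho> \<and> \<Union>C = space \<rho> \<and> (\<forall>a\<in>C. emeasure \<rho> a \<noteq> \<infinity>)"
    by (rule exI[of _ "insert {0} (range A)"])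
       (use fin cover null in \<open>auto simp: space less_top[symmetric]\<close>)
qed

lemma integrable_levy_kernel:
  assumes "levy_measure \<rho>"
  shows "integrable \<rho> (levy_kernel u)"
proof (rule Bochner_Integration.integrable_bound)
  have [measurable_cong]: "sets \<rho> = sets borel" using assms by (simp add: levy_measure_def)
  show "integrable \<rho> (\<lambda>t. (2 + u\<^sup>2) * min 1 (t\<^sup>2))"
    using levy_measure_integrable[OF assms] by (rule integrable_mult_right)
  show "AE t in \<rho>. norm (levy_kernel u t) \<le> norm ((2 + u\<^sup>2) * min 1 (t\<^sup>2))"
    using norm_levy_kernel[of u] by (intro AE_I2) (smt (verit) real_norm_def)
  show "levy_kernel u \<in> borel_measurable \<rho>" by measurable
qed

lemma isCont_levy_integral:
  assumes "levy_measure \<rho>"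
  shows "isCont (\<lambda>u. integral\<^sup>L \<rho> (levy_kernel u)) u"
  unfolding continuous_at_sequentially
proof (intro allI impI)
  have [measurable_cong]: "sets \<rho> = sets borel" using assms by (simp add: levy_measure_def)
  fix X :: "nat \<Rightarrow> real" assume X: "X \<longlonglongrightarrow> u"
  then obtain B where B: "\<And>n. \<bar>X n\<bar> \<le> B"
    using convergent_imp_Bseq[of X] by (auto simp: convergent_def Bseq_def)
  have "(\<lambda>n. integral\<^sup>L \<rho> (levy_kernel (X n))) \<longlonglongrightarrow> integral\<^sup>L \<rho> (levy_kernel u)"
  proof (rule integral_dominated_convergence)
    show "integrable \<rho> (\<lambda>t. (2 + B\<^sup>2) * min 1 (t\<^sup>2))"
      using levy_measure_integrable[OF assms] by (rule integrable_mult_right)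
    show "AE t in \<rho>. (\<lambda>n. levy_kernel (X n) t) \<longlonglongrightarrow> levy_kernel u t"
      unfolding levy_kernel_def by (intro AE_I2 tendsto_intros X)
    fix n
    show "AE t in \<rho>. norm (levy_kernel (X n) t) \<le> (2 + B\<^sup>2) * min 1 (t\<^sup>2)"
    proof (intro AE_I2)
      fix t :: real
      have "(X n)\<^sup>2 \<le> B\<^sup>2" using B[of n] by (metis abs_le_square_iff abs_ge_self order_trans)
      then have "(2 + (X n)\<^sup>2) * min 1 (t\<^sup>2) \<le> (2 + B\<^sup>2) * min 1 (t\<^sup>2)"
        by (intro mult_right_mono) auto
      with norm_levy_kernel[of "X n" t] show "norm (levy_kernel (X n) t) \<le> (2 + B\<^sup>2) * min 1 (t\<^sup>2)"
        by linarith
    qed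
  qed measurable
  then show "((\<lambda>u. integral\<^sup>L \<rho> (levy_kernel u)) \<circ> X) \<longlonglongrightarrow> integral\<^sup>L \<rho> (levy_kernel u)"
    by (simp add: o_def)
qed

text \<open>
  The difference of two continuous logarithms of the same function is continuous with values in
  \<open>2 \<pi> \<i> \<int>\<close>, hence constant.
\<close>

lemma continuous_exp_eq_imp_eq:
  fixes f g :: "real \<Rightarrow> complex"
  assumes cont: "continuous_on UNIV f" "continuous_on UNIV g"
    and exp: "\<And>u. exp (f u) = exp (g u)" and 0: "f 0 = g 0"
  shows "f u = g u"
proof -
  have "(\<lambda>u. f u - g u) constant_on UNIV"
  proof (rule continuous_discrete_range_constant)
    show "continuous_on UNIV (\<lambda>u. f u - g u)" using cont by (intro continuous_intros)
    fix x :: real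
    show "\<exists>e>0. \<forall>y. y \<in> UNIV \<and> f y - g y \<noteq> f x - g x \<longrightarrow> e \<le> norm (f y - g y - (f x - g x))"
    \<comment> \<open>Distinct values differ by a nonzero multiple of \<open>2 \<pi> \<i>\<close>.\<close>
    proof (intro exI[of _ "2 * pi"] conjI allI impI)
      fix y assume ne: "y \<in> UNIV \<and> f y - g y \<noteq> f x - g x"
      define d where "d = f y - g y - (f x - g x)"
      have "exp d = 1" using exp[of x] exp[of y] by (simp add: d_def exp_diff)
      then obtain n :: int where n: "Re d = 0" "Im d = of_int (2 * n) * pi"
        by (auto simp: exp_eq_1)
      have "d \<noteq> 0" using ne by (simp add: d_def)
      then have "n \<noteq> 0" using n by (auto simp: complex_eq_iff)
      then have "1 \<le> \<bar>real_of_int n\<bar>" by linarith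
      then have "2 * pi * 1 \<le> 2 * pi * \<bar>real_of_int n\<bar>" by (intro mult_left_mono) auto
      also have "\<dots> = \<bar>Im d\<bar>" unfolding n by (simp add: abs_mult)
      finally show "2 * pi \<le> norm (f y - g y - (f x - g x))"
        using abs_Im_le_cmod[of d] by (simp add: d_def)
    qed simp
  qed simp
  then show ?thesis using 0 unfolding constant_on_def by (metis UNIV_I eq_iff_diff_eq_0)
qed

text \<open>
  Both sides are continuous logarithms of the characteristic function that vanish at \<open>0\<close>.
\<close>

lemma levy_exponent_gamma:
  assumes \<alpha>: "0 < \<alpha>" and ct: "characteristic_triplet (gamma_distribution \<alpha>) a \<rho> \<eta>"
  shows "\<i> * of_real (\<eta> * u) - of_real (a * u\<^sup>2 / 2) + integral\<^sup>L \<rho> (levy_kernel u)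
    = - of_real \<alpha> * Ln (1 - \<i> * of_real u)"
proof (rule continuous_exp_eq_imp_eq)
  have \<rho>: "levy_measure \<rho>" using ct by (simp add: characteristic_triplet_def)
  show "continuous_on UNIV (\<lambda>u. \<i> * of_real (\<eta> * u) - of_real (a * u\<^sup>2 / 2) + integral\<^sup>L \<rho> (levy_kernel u))"
    by (intro continuous_intros continuous_at_imp_continuous_on ballI isCont_levy_integral[OF \<rho>])
       simp_all
  show "continuous_on UNIV (\<lambda>u. - of_real \<alpha> * Ln (1 - \<i> * of_real u))"
    using one_minus_i_not_nonpos by (intro continuous_intros) auto
  show "exp (\<i> * of_real (\<eta> * u) - of_real (a * u\<^sup>2 / 2) + integral\<^sup>L \<rho> (levy_kernel u))
      = exp (- of_real \<alpha> * Ln (1 - \<i> * of_real u))" for u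
    using ct char_gamma_distribution[OF \<alpha>, of u]
    by (simp add: characteristic_triplet_def levy_kernel_def[abs_def])
  show "\<i> * of_real (\<eta> * 0) - of_real (a * 0\<^sup>2 / 2) + integral\<^sup>L \<rho> (levy_kernel 0)
      = - of_real \<alpha> * Ln (1 - \<i> * of_real 0)"
    by (simp add: levy_kernel_def[abs_def])
qed

text \<open>
  This is where the free representation comes from: averaging the classical kernel over the
  dilations \<open>u * x\<close> with \<open>x\<close> exponential turns \<open>iexp (u * t)\<close> into \<open>1 / (1 - \<i> u t)\<close>, and leaves
  the compensating terms unchanged since \<open>x\<close> has mean \<open>1\<close>.
\<close>

lemma levy_kernel_exp_law:
  "(LINT x|exp_law. levy_kernel (u * x) t)
    = 1 / (1 - of_real t * (\<i> * of_real u)) - 1 - of_real t * (\<i> * of_real u) * indicator {-1..1} t"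
proof -
  define v where "v = u * t"
  have i1: "integrable exp_law (\<lambda>x. iexp (v * x))"
    by (rule exp_law.integrable_const_bound[where B = 1]) auto
  have i2: "integrable exp_law (\<lambda>x. complex_of_real x)"
    using integrable_exp_law_power[of 1] by (simp add: integrable_of_real)
  have "(1 - \<i> * of_real v) * (LINT x|exp_law. iexp (v * x)) = 1"
  proof -
    have "(LINT x|exp_law. iexp (v * x)) = 1 + (LINT x|exp_law. \<i> * of_real v * iexp (v * x))"
    proof (rule exp_law_by_parts[OF has_vector_derivative_iexp _ i1])
      show "isCont (\<lambda>x. \<i> * of_real v * iexp (v * x)) x" for x by (intro continuous_intros)
      show "integrable exp_law (\<lambda>x. \<i> * of_real v * iexp (v * x))"
        using i1 by (rule integrable_mult_right)
      have "((\<lambda>x. iexp (v * x)) \<longlongrightarrow> iexp (v * 0)) (at_right 0)" by (intro tendsto_intros)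
      then show "((\<lambda>x. iexp (v * x)) \<longlongrightarrow> 1) (at_right 0)" by simp
      have lim: "((\<lambda>x::real. exp (- x)) \<longlongrightarrow> 0) at_top" by real_asymp
      show "((\<lambda>x. exp (- x) *\<^sub>R iexp (v * x)) \<longlongrightarrow> 0) at_top"
        by (rule Lim_null_comparison[OF _ lim]) (simp add: always_eventually)
    qed
    also have "(LINT x|exp_law. \<i> * of_real v * iexp (v * x)) = \<i> * of_real v * (LINT x|exp_law. iexp (v * x))"
      by (rule integral_mult_right_zero)
    finally show ?thesis by (simp add: algebra_simps)
  qed
  then have I: "(LINT x|exp_law. iexp (v * x)) = 1 / (1 - \<i> * of_real v)"
    using one_minus_i_nz[of v] by (simp add: field_simps)
  have X: "(LINT x|exp_law. complex_of_real x) = 1"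
    using integral_exp_law_power[of 1] by simp
  have "(LINT x|exp_law. levy_kernel (u * x) t)
      = (LINT x|exp_law. iexp (v * x) - 1 - \<i> * of_real v * indicator {-1..1} t * of_real x)"
    unfolding levy_kernel_def v_def by (simp add: mult.commute mult.left_commute mult.assoc)
  also have "\<dots> = (LINT x|exp_law. iexp (v * x)) - 1
      - \<i> * of_real v * indicator {-1..1} t * (LINT x|exp_law. complex_of_real x)"
    using i1 i2 exp_law.prob_space[simplified] by simp
  finally show ?thesis
    unfolding I X by (simp add: v_def mult.commute mult.left_commute mult.assoc)
qed

lemma exp_law_levy_kernel_swap:
  assumes \<rho>: "levy_measure \<rho>"
  shows "integrable exp_law (\<lambda>x. integral\<^sup>L \<rho> (levy_kernel (u * x)))" (is ?A)
    and "(LINT x|exp_law. integral\<^sup>L \<rho> (levy_kernel (u * x)))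
      = (LINT t|\<rho>. LINT x|exp_law. levy_kernel (u * x) t)" (is ?B)
proof -
  have sets [measurable_cong]: "sets \<rho> = sets borel" using \<rho> by (simp add: levy_measure_def)
  interpret \<rho>: sigma_finite_measure \<rho> by (rule sigma_finite_levy_measure[OF \<rho>])
  interpret P: pair_sigma_finite exp_law \<rho> ..
  let ?m = "LINT t|\<rho>. min 1 (t\<^sup>2)"
  have meas: "(\<lambda>(x, t). levy_kernel (u * x) t) \<in> borel_measurable (exp_law \<Otimes>\<^sub>M \<rho>)"
    unfolding levy_kernel_def by measurable
  have int: "integrable (exp_law \<Otimes>\<^sub>M \<rho>) (\<lambda>(x, t). levy_kernel (u * x) t)"
  proof (rule P.Fubini_integrable[OF meas])
    have "integrable exp_law (\<lambda>x. (2 + u\<^sup>2 * x ^ 2) * ?m)"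
      by (intro integrable_mult_left Bochner_Integration.integrable_add integrable_mult_right
          integrable_exp_law_power exp_law.integrable_const)
    then show "integrable exp_law (\<lambda>x. LINT t|\<rho>. norm (case (x, t) of (x, t) \<Rightarrow> levy_kernel (u * x) t))"
    proof (rule Bochner_Integration.integrable_bound)
      show "AE x in exp_law. norm (LINT t|\<rho>. norm (case (x, t) of (x, t) \<Rightarrow> levy_kernel (u * x) t))
          \<le> norm ((2 + u\<^sup>2 * x ^ 2) * ?m)"
      proof (intro AE_I2)
        fix x :: real
        have "(LINT t|\<rho>. norm (levy_kernel (u * x) t)) \<le> (LINT t|\<rho>. (2 + (u * x)\<^sup>2) * min 1 (t\<^sup>2))"
          using integrable_levy_kernel[OF \<rho>, of "u * x"] levy_measure_integrable[OF \<rho>]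
          by (intro integral_mono integrable_mult_right integrable_norm norm_levy_kernel)
        also have "\<dots> = (2 + u\<^sup>2 * x ^ 2) * ?m" by (simp add: power_mult_distrib)
        finally show "norm (LINT t|\<rho>. norm (case (x, t) of (x, t) \<Rightarrow> levy_kernel (u * x) t))
          \<le> norm ((2 + u\<^sup>2 * x ^ 2) * ?m)" by simp
      qed
    qed (use meas in measurable)
  qed (use integrable_levy_kernel[OF \<rho>] in simp)
  from P.integrable_fst[OF int] show ?A by simp
  from P.Fubini_integral[OF int] show ?B by simp
qed

text \<open>
  Integration by parts; the logarithm is at most \<open>\<bar>u x\<bar> + pi\<close> in modulus, so the boundary term at
  infinity vanishes.
\<close>

lemma exp_law_Ln:
  "(LINT x|exp_law. Ln (1 - \<i> * of_real (u * x)))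
    = - (\<i> * of_real u) * (LINT x|exp_law. 1 / (1 - \<i> * of_real u * of_real x))"
proof -
  have bound: "cmod (Ln (1 - \<i> * of_real v)) \<le> \<bar>v\<bar> + pi" for v
  proof -
    define z where "z = 1 - \<i> * complex_of_real v"
    have z0: "z \<noteq> 0" using one_minus_i_nz by (simp add: z_def)
    have "1 \<le> cmod z" using abs_Re_le_cmod[of z] by (simp add: z_def)
    moreover have "cmod z \<le> 1 + \<bar>v\<bar>"
      unfolding z_def using norm_triangle_ineq4[of 1 "\<i> * complex_of_real v"] by (simp add: norm_mult)
    ultimately have "\<bar>Re (Ln z)\<bar> \<le> \<bar>v\<bar>"
      using ln_le_minus_one[of "cmod z"] z0 by simp
    moreover have "\<bar>Im (Ln z)\<bar> \<le> pi" using Im_Ln_le_pi[OF z0] mpi_less_Im_Ln[OF z0] by linarith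
    ultimately show ?thesis using cmod_le[of "Ln z"] unfolding z_def by linarith
  qed
  let ?H = "\<lambda>x. Ln (1 - \<i> * of_real (u * x))"
  let ?H' = "\<lambda>x. - (\<i> * of_real u) * (1 / (1 - \<i> * of_real u * of_real x))"
  have "integral\<^sup>L exp_law ?H = 0 + integral\<^sup>L exp_law ?H'"
  proof (rule exp_law_by_parts)
    fix x :: real
    have nn: "1 - \<i> * (of_real u * of_real x) \<notin> \<real>\<^sub>\<le>\<^sub>0" "1 - \<i> * of_real u * of_real x \<noteq> 0"
      using one_minus_i_not_nonpos[of "u * x"] one_minus_i_nz[of "u * x"] by (simp_all add: mult.assoc)
    have "((\<lambda>z. Ln (1 - \<i> * (of_real u * z))) has_field_derivative ?H' x) (at (of_real x))"
      using nn by (auto intro!: derivative_eq_intros simp: field_simps)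
    from has_vector_derivative_real_field[OF this]
    show "(?H has_vector_derivative ?H' x) (at x)" by simp
    show "isCont ?H' x" using nn by (intro continuous_intros) auto
  next
    show "integrable exp_law ?H"
    proof (rule Bochner_Integration.integrable_bound)
      show "integrable exp_law (\<lambda>x. \<bar>u\<bar> * \<bar>x\<bar> + pi)"
        using integrable_exp_law_power[of 1] by (intro Bochner_Integration.integrable_add integrable_mult_right) auto
      show "AE x in exp_law. norm (?H x) \<le> norm (\<bar>u\<bar> * \<bar>x\<bar> + pi)"
      proof (intro AE_I2)
        fix x show "norm (?H x) \<le> norm (\<bar>u\<bar> * \<bar>x\<bar> + pi)"
          using bound[of "u * x"] by (simp add: abs_mult)
      qed
    qed measurable
    have "integrable exp_law (\<lambda>x. 1 / (1 - \<i> * of_real u * of_real x))"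
    proof (rule integrable_bounded_inverse[of _ _ 1])
      show "AE x in exp_law. 1 \<le> cmod (1 - \<i> * of_real u * of_real x)"
      proof (intro AE_I2)
        fix x show "1 \<le> cmod (1 - \<i> * of_real u * of_real x)"
          using abs_Re_le_cmod[of "1 - \<i> * of_real u * of_real x"] by simp
      qed
    qed (auto intro: exp_law.finite_measure_axioms)
    then show "integrable exp_law ?H'" by (rule integrable_mult_right)
    have "(?H \<longlongrightarrow> Ln (1 - \<i> * of_real (u * 0))) (at_right 0)"
      by (intro tendsto_intros) auto
    then show "(?H \<longlongrightarrow> 0) (at_right 0)" by simp
    show "((\<lambda>x. exp (- x) *\<^sub>R ?H x) \<longlongrightarrow> 0) at_top"
    proof (rule Lim_null_comparison)
      show "((\<lambda>x::real. exp (- x) * (\<bar>u\<bar> * \<bar>x\<bar> + pi)) \<longlongrightarrow> 0) at_top"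
        by real_asymp
      show "\<forall>\<^sub>F x in at_top. norm (exp (- x) *\<^sub>R ?H x) \<le> exp (- x) * (\<bar>u\<bar> * \<bar>x\<bar> + pi)"
      proof (intro always_eventually allI)
        fix x show "norm (exp (- x) *\<^sub>R ?H x) \<le> exp (- x) * (\<bar>u\<bar> * \<bar>x\<bar> + pi)"
          using bound[of "u * x"] by (simp add: abs_mult)
      qed
    qed
  qed
  also have "integral\<^sup>L exp_law ?H' = - (\<i> * of_real u) * (LINT x|exp_law. 1 / (1 - \<i> * of_real u * of_real x))"
    by (rule integral_mult_right_zero)
  finally show ?thesis by simp
qed

text \<open>
  Both sides are the mean of the classical exponent at \<open>u * x\<close> for exponential \<open>x\<close>. On the left
  the representation by the triplet is averaged term by term; the Gaussian term becomes \<open>a z\<^sup>2\<close>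
  because \<open>x\<close> has second moment \<open>2\<close>. On the right the closed form \<open>- \<alpha> Ln (1 - \<i> u x)\<close> is
  averaged.
\<close>

lemma free_cumulant_gamma:
  assumes \<alpha>: "0 < \<alpha>" and ct: "characteristic_triplet (gamma_distribution \<alpha>) a \<rho> \<eta>"
    and z: "z = \<i> * of_real u"
  shows "of_real \<eta> * z + of_real a * z\<^sup>2
      + (CLINT t|\<rho>. 1 / (1 - of_real t * z) - 1 - of_real t * z * indicator {-1..1} t)
    = of_real \<alpha> * z * (CLINT x|exp_law. 1 / (1 - z * of_real x))"
proof -
  have \<rho>: "levy_measure \<rho>" using ct by (simp add: characteristic_triplet_def)
  note swap = exp_law_levy_kernel_swap[OF \<rho>, of u]
  have i1: "integrable exp_law (\<lambda>x. \<i> * of_real \<eta> * of_real u * complex_of_real (x ^ 1))"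
    and i2: "integrable exp_law (\<lambda>x. of_real (a * u\<^sup>2 / 2) * complex_of_real (x ^ 2))"
    by (intro integrable_mult_right integrable_of_real integrable_exp_law_power)+
  have "(LINT x|exp_law. - of_real \<alpha> * Ln (1 - \<i> * of_real (u * x)))
      = (LINT x|exp_law. \<i> * of_real \<eta> * of_real u * complex_of_real (x ^ 1)
          - of_real (a * u\<^sup>2 / 2) * complex_of_real (x ^ 2) + integral\<^sup>L \<rho> (levy_kernel (u * x)))"
  proof (rule Bochner_Integration.integral_cong[OF refl])
    fix x :: real
    show "- of_real \<alpha> * Ln (1 - \<i> * of_real (u * x))
        = \<i> * of_real \<eta> * of_real u * complex_of_real (x ^ 1)
          - of_real (a * u\<^sup>2 / 2) * complex_of_real (x ^ 2) + integral\<^sup>L \<rho> (levy_kernel (u * x))"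
      using levy_exponent_gamma[OF \<alpha> ct, of "u * x", symmetric]
      by (simp add: power_mult_distrib mult.assoc)
  qed
  also have "\<dots> = (LINT x|exp_law. \<i> * of_real \<eta> * of_real u * complex_of_real (x ^ 1))
      - (LINT x|exp_law. of_real (a * u\<^sup>2 / 2) * complex_of_real (x ^ 2))
      + (LINT x|exp_law. integral\<^sup>L \<rho> (levy_kernel (u * x)))"
    by (subst Bochner_Integration.integral_add[OF Bochner_Integration.integrable_diff[OF i1 i2] swap(1)],
        subst Bochner_Integration.integral_diff[OF i1 i2]) (rule refl)
  also have "\<dots> = of_real \<eta> * z + of_real a * z\<^sup>2
      + (CLINT t|\<rho>. 1 / (1 - of_real t * z) - 1 - of_real t * z * indicator {-1..1} t)"
    unfolding integral_mult_right_zero integral_complex_of_real integral_exp_law_power swap(2)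
      levy_kernel_exp_law z
    by (simp add: power_mult_distrib)
  finally have "of_real \<eta> * z + of_real a * z\<^sup>2
      + (CLINT t|\<rho>. 1 / (1 - of_real t * z) - 1 - of_real t * z * indicator {-1..1} t)
      = (LINT x|exp_law. - of_real \<alpha> * Ln (1 - \<i> * of_real (u * x)))" ..
  also have "\<dots> = - of_real \<alpha> * (LINT x|exp_law. Ln (1 - \<i> * of_real (u * x)))"
    by (rule integral_mult_right_zero)
  also have "\<dots> = of_real \<alpha> * z * (CLINT x|exp_law. 1 / (1 - z * of_real x))"
    unfolding exp_law_Ln z by simp
  finally show ?thesis .
qed

section \<open>The Cauchy transform of the free Gamma law\<close>

text \<open>
  The second-order remainder of \<open>1 / (z - t)\<close> in \<open>z\<close> is at most \<open>2 \<bar>h\<bar>\<^sup>2 / \<delta>\<^sup>3\<close>, uniformly in \<open>t\<close>.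
  The condition on the distance covers non-real points for every measure, and negative reals for a
  measure on the positive half-line.
\<close>

lemma has_field_derivative_cauchy_transform:
  assumes fin: "finite_measure M" and sets [measurable_cong]: "sets M = sets borel"
    and \<delta>: "0 < \<delta>" and away: "AE t in M. \<delta> \<le> cmod (z - of_real t)"
  shows "(cauchy_transform M has_field_derivative - (CLINT t|M. 1 / (z - of_real t)\<^sup>2)) (at z)"
  unfolding has_field_derivative_def
proof (rule has_derivative_of_quadratic_remainder[where \<delta> = "\<delta> / 2"])
  define D where "D = (CLINT t|M. 1 / (z - of_real t)\<^sup>2)"
  fix h assume h: "cmod h < \<delta> / 2"
  have away': "AE t in M. \<delta> / 2 \<le> cmod (z + h - of_real t)"
    using away
  proof eventually_elim
    case (elim t)
    have "cmod (z - of_real t) \<le> cmod (z + h - of_real t) + cmod h"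
      using norm_triangle_ineq4[of "z + h - of_real t" h] by simp
    with elim h show ?case by simp
  qed
  have away2: "AE t in M. \<delta>\<^sup>2 \<le> cmod ((z - of_real t)\<^sup>2)"
    using away by eventually_elim (use \<delta> in \<open>auto simp: norm_power intro!: power_mono\<close>)
  have i1: "integrable M (\<lambda>t. 1 / (z + h - of_real t))"
    by (rule integrable_bounded_inverse[OF fin sets _ _ away']) (use \<delta> in auto)
  have i2: "integrable M (\<lambda>t. 1 / (z - of_real t))"
    by (rule integrable_bounded_inverse[OF fin sets _ \<delta> away]) auto
  have i3: "integrable M (\<lambda>t. 1 / (z - of_real t)\<^sup>2)"
    by (rule integrable_bounded_inverse[OF fin sets _ _ away2]) (use \<delta> in auto)
  have eq: "cauchy_transform M (z + h) - cauchy_transform M z - - D * h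
      = (CLINT t|M. 1 / (z + h - of_real t) - 1 / (z - of_real t) + 1 / (z - of_real t)\<^sup>2 * h)"
    unfolding cauchy_transform_def D_def using i1 i2 i3
    by (simp del: times_divide_eq_left times_divide_eq_right)
  have bound: "AE t in M. cmod (1 / (z + h - of_real t) - 1 / (z - of_real t) + 1 / (z - of_real t)\<^sup>2 * h)
      \<le> 2 / \<delta> ^ 3 * (cmod h)\<^sup>2"
    using away away' 
  proof eventually_elim
    case (elim t)
    define p q where "p = z - of_real t" and "q = z + h - of_real t"
    have pq: "\<delta> \<le> cmod p" "\<delta> / 2 \<le> cmod q" "q = p + h"
      using elim by (simp_all add: p_def q_def)
    then have nz: "p \<noteq> 0" "q \<noteq> 0" using \<delta> by auto
    have "1 / q - 1 / p + 1 / p\<^sup>2 * h = h\<^sup>2 / (q * p\<^sup>2)"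
    proof -
      have h: "h = q - p" using pq(3) by simp
      show ?thesis unfolding h using nz by (simp add: field_simps power2_eq_square)
    qed
    also have "cmod \<dots> = (cmod h)\<^sup>2 / (cmod q * (cmod p)\<^sup>2)"
      by (simp add: norm_divide norm_mult norm_power)
    also have "\<dots> \<le> (cmod h)\<^sup>2 / (\<delta> / 2 * \<delta>\<^sup>2)"
      using pq \<delta> by (intro divide_left_mono mult_mono power_mono mult_pos_pos) auto
    also have "\<dots> = 2 / \<delta> ^ 3 * (cmod h)\<^sup>2"
      by (simp add: field_simps power2_eq_square power3_eq_cube)
    finally show ?case unfolding p_def q_def .
  qed
  have "cmod (cauchy_transform M (z + h) - cauchy_transform M z - - D * h)
      \<le> (LINT t|M. cmod (1 / (z + h - of_real t) - 1 / (z - of_real t) + 1 / (z - of_real t)\<^sup>2 * h))"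
    unfolding eq by (rule integral_norm_bound)
  also have "\<dots> \<le> (LINT t|M. 2 / \<delta> ^ 3 * (cmod h)\<^sup>2)"
    by (rule integral_mono_AE[OF _ finite_measure.integrable_const[OF fin] bound])
       (rule integrable_norm[OF Bochner_Integration.integrable_add[OF
          Bochner_Integration.integrable_diff[OF i1 i2] integrable_mult_left[OF i3]]])
  also have "\<dots> = measure M (space M) * (2 / \<delta> ^ 3) * (cmod h)\<^sup>2"
    by simp
  finally show "cmod (cauchy_transform M (z + h) - cauchy_transform M z - - D * h)
      \<le> measure M (space M) * (2 / \<delta> ^ 3) * (cmod h)\<^sup>2" .
qed (use \<delta> in \<open>auto intro: bounded_linear_mult_right\<close>)

lemma cmod_diff_of_real_ge_Im: "\<bar>Im z\<bar> \<le> cmod (z - of_real t)"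
  using abs_Im_le_cmod[of "z - of_real t"] by simp

lemma holomorphic_cauchy_transform:
  assumes "finite_measure M" "sets M = sets borel"
  shows "cauchy_transform M holomorphic_on {z. 0 < Im z}"
proof (rule holomorphic_onI)
  fix z :: complex assume "z \<in> {z. 0 < Im z}"
  then have "\<bar>Im z\<bar> > 0" by simp
  then have "(cauchy_transform M has_field_derivative - (CLINT t|M. 1 / (z - of_real t)\<^sup>2)) (at z)"
    by (intro has_field_derivative_cauchy_transform[OF assms, of "\<bar>Im z\<bar>"])
       (auto intro!: AE_I2 cmod_diff_of_real_ge_Im simp del: abs_of_pos)
  then show "cauchy_transform M field_differentiable at z within {z. 0 < Im z}"
    using field_differentiable_at_within field_differentiable_def by blast
qed

lemma isCont_cauchy_transform:
  assumes "finite_measure M" "sets M = sets borel" "AE t in M. 0 \<le> t" "x < 0"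
  shows "isCont (cauchy_transform M) (of_real x)"
proof -
  have "AE t in M. - x \<le> cmod (of_real x - of_real t)"
    using assms(3)
  proof eventually_elim
    case (elim t)
    then have "- x \<le> \<bar>x - t\<bar>" using assms(4) by simp
    then show ?case by (metis norm_of_real of_real_diff)
  qed
  from has_field_derivative_cauchy_transform[OF assms(1,2) _ this] assms(4) show ?thesis
    by (auto intro: DERIV_isCont)
qed

text \<open>
  The imaginary part is a Poisson integral of the measure. Its sign keeps the values of the Cauchy
  transform in the lower half-plane, where \<open>free_gamma_K\<close> is holomorphic.
\<close>

lemma Im_cauchy_transform:
  assumes "prob_space M" and sets [measurable_cong]: "sets M = sets borel" and z: "0 < Im z"
  shows "Im (cauchy_transform M z) = - (LINT t|M. Im z / (cmod (z - of_real t))\<^sup>2)" (is ?A)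
    and "integrable M (\<lambda>t. Im z / (cmod (z - of_real t))\<^sup>2)" (is ?B)
    and "Im (cauchy_transform M z) < 0" (is ?C)
proof -
  interpret prob_space M by fact
  have int: "integrable M (\<lambda>t. 1 / (z - of_real t))"
    by (rule integrable_bounded_inverse[OF finite_measure_axioms sets _ z])
       (use cmod_diff_of_real_ge_Im[of z] z in auto)
  have Im: "Im (1 / (z - of_real t)) = - (Im z / (cmod (z - of_real t))\<^sup>2)" for t
    by (simp add: Im_divide cmod_power2)
  have "integrable M (\<lambda>t. Im (1 / (z - of_real t)))" using int by (rule integrable_Im)
  then show B: ?B unfolding Im using Bochner_Integration.integrable_minus by fastforce
  have "Im (cauchy_transform M z) = (LINT t|M. Im (1 / (z - of_real t)))"
    unfolding cauchy_transform_def using int by (rule integral_Im[symmetric])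
  also have "\<dots> = - (LINT t|M. Im z / (cmod (z - of_real t))\<^sup>2)"
    unfolding Im by simp
  finally show A: ?A .
  have pos: "0 < Im z / (cmod (z - of_real t))\<^sup>2" for t
  proof -
    have "z - of_real t \<noteq> 0" using z cmod_diff_of_real_ge_Im[of z t] by auto
    then show ?thesis using z by simp
  qed
  have "(LINT t|M. Im z / (cmod (z - of_real t))\<^sup>2) \<noteq> 0"
  proof
    assume "(LINT t|M. Im z / (cmod (z - of_real t))\<^sup>2) = 0"
    then have "AE t in M. Im z / (cmod (z - of_real t))\<^sup>2 = 0"
      by (subst integral_nonneg_eq_0_iff_AE[OF B, symmetric]) (use pos in \<open>auto intro: less_imp_le\<close>)
    then have "AE t in M. False" by eventually_elim (use pos in \<open>metis less_irrefl\<close>)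
    then show False by simp
  qed
  moreover have "0 \<le> (LINT t|M. Im z / (cmod (z - of_real t))\<^sup>2)"
    using pos by (intro integral_nonneg_AE) (auto intro: less_imp_le)
  ultimately show ?C unfolding A by simp
qed

text \<open>
  The candidate \<open>1 / z + \<alpha> \<integral> exp (- x) / (1 - z x) dx\<close> for the inverse of the Cauchy transform
  (see \<open>free_gamma_K_eq\<close>). Written through the Cauchy transform of the exponential law, it
  inherits holomorphy and continuity from the general results above.
\<close>

definition free_gamma_K :: "real \<Rightarrow> complex \<Rightarrow> complex" where
  "free_gamma_K \<alpha> z = 1 / z + of_real \<alpha> / z * cauchy_transform exp_law (1 / z)"

lemma free_gamma_K_eq:
  assumes "z \<noteq> 0"
  shows "free_gamma_K \<alpha> z = 1 / z + of_real \<alpha> * (CLINT x|exp_law. 1 / (1 - z * of_real x))"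
proof -
  have "1 / z * cauchy_transform exp_law (1 / z) = (CLINT x|exp_law. 1 / z * (1 / (1 / z - of_real x)))"
    unfolding cauchy_transform_def by (rule integral_mult_right_zero[symmetric])
  also have "(\<lambda>x. 1 / z * (1 / (1 / z - of_real x))) = (\<lambda>x. 1 / (1 - z * of_real x))"
    using assms by (auto simp: divide_simps algebra_simps)
  finally have "1 / z * cauchy_transform exp_law (1 / z) = (CLINT x|exp_law. 1 / (1 - z * of_real x))" .
  moreover have "of_real \<alpha> / z * cauchy_transform exp_law (1 / z)
      = of_real \<alpha> * (1 / z * cauchy_transform exp_law (1 / z))" by simp
  ultimately show ?thesis unfolding free_gamma_K_def by (simp only:)
qed

lemma Im_inverse_pos: "Im z < 0 \<Longrightarrow> 0 < Im (1 / z)"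
  by (simp add: Im_divide divide_neg_pos sum_power2_gt_zero_iff)

lemma holomorphic_free_gamma_K: "free_gamma_K \<alpha> holomorphic_on {z. Im z < 0}"
proof -
  have "(cauchy_transform exp_law \<circ> (\<lambda>z. 1 / z)) holomorphic_on {z. Im z < 0}"
    by (rule holomorphic_on_compose_gen[OF _ holomorphic_cauchy_transform])
       (use Im_inverse_pos in \<open>auto intro!: holomorphic_intros exp_law.finite_measure_axioms\<close>)
  then show ?thesis
    unfolding free_gamma_K_def[abs_def] o_def
    by (intro holomorphic_intros) auto
qed

text \<open>
  The points \<open>K (\<i> u)\<close> form a non-constant continuous curve in the upper half-plane, since \<open>G\<close>
  recovers \<open>\<i> u\<close> from them. On this curve \<open>K \<circ> G\<close> is the identity, and the identity theorem
  extends this to the half-plane.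
\<close>

lemma free_gamma_K_right_inverse:
  assumes \<nu>: "prob_space \<nu>" "sets \<nu> = sets borel" and M: "0 < M"
    and K: "\<And>u. - 1 / M < u \<Longrightarrow> u < 0 \<Longrightarrow>
      0 < Im (free_gamma_K \<alpha> (\<i> * of_real u)) \<and>
      cauchy_transform \<nu> (free_gamma_K \<alpha> (\<i> * of_real u)) = \<i> * of_real u"
    and w: "0 < Im w"
  shows "free_gamma_K \<alpha> (cauchy_transform \<nu> w) = w"
proof -
  define J where "J = {- 1 / M <..< 0}"
  define k where "k u = free_gamma_K \<alpha> (\<i> * of_real u)" for u
  define u0 where "u0 = - 1 / (2 * M)"
  have u0: "u0 \<in> J" using M by (auto simp: J_def u0_def field_simps)
  have fin: "finite_measure \<nu>" using \<nu>(1) by (rule prob_space.finite_measure)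
  have holo: "(\<lambda>w. free_gamma_K \<alpha> (cauchy_transform \<nu> w) - w) holomorphic_on {w. 0 < Im w}"
  proof -
    have "(free_gamma_K \<alpha> \<circ> cauchy_transform \<nu>) holomorphic_on {w. 0 < Im w}"
      by (rule holomorphic_on_compose_gen[OF holomorphic_cauchy_transform[OF fin \<nu>(2)]
            holomorphic_free_gamma_K]) (use Im_cauchy_transform(3)[OF \<nu>] in auto)
    then show ?thesis by (auto intro!: holomorphic_intros simp: o_def)
  qed
  have conn: "connected {w. 0 < Im w}" "open {w. 0 < Im w}"
    by (auto intro: convex_connected convex_halfspace_Im_gt open_halfspace_Im_gt)
  have inj: "k u \<noteq> k u'" if "u \<in> J" "u' \<in> J" "u \<noteq> u'" for u u'
    using K[of u] K[of u'] that by (auto simp: J_def k_def)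
  have cont: "continuous_on J k"
  proof -
    have "continuous_on J (free_gamma_K \<alpha> \<circ> (\<lambda>u. \<i> * of_real u))"
      by (intro continuous_on_compose continuous_intros
          continuous_on_subset[OF holomorphic_on_imp_continuous_on[OF holomorphic_free_gamma_K]])
         (auto simp: J_def)
    then show ?thesis by (simp add: k_def[abs_def] o_def)
  qed
  have lim: "k u0 islimpt k ` J"
    unfolding islimpt_approachable
  proof (intro allI impI)
    fix e :: real assume "0 < e"
    then obtain d where d: "0 < d" "\<And>u. u \<in> J \<Longrightarrow> dist u u0 < d \<Longrightarrow> dist (k u) (k u0) < e"
      using cont u0 unfolding continuous_on_iff by blast
    \<comment> \<open>The second bound keeps \<open>u\<close> inside \<open>J\<close>: it moves \<open>u0\<close> at most half of the way to \<open>0\<close>.\<close>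
    define u where "u = u0 + min (d / 2) (1 / (4 * M))"
    have "0 < min (d / 2) (1 / (4 * M))" using d M by simp
    moreover have "u0 + 1 / (4 * M) < 0" using M by (simp add: u0_def field_simps)
    ultimately have "u \<in> J" "u \<noteq> u0" "dist u u0 < d"
      using u0 d by (auto simp: u_def J_def dist_real_def)
    then show "\<exists>x'\<in>k ` J. x' \<noteq> k u0 \<and> dist x' (k u0) < e"
      using d(2)[of u] inj[of u u0] u0 by blast
  qed
  have "free_gamma_K \<alpha> (cauchy_transform \<nu> w) - w = 0"
  proof (rule analytic_continuation[OF holo conn(2,1) _ _ lim])
    show "k ` J \<subseteq> {w. 0 < Im w}" "k u0 \<in> {w. 0 < Im w}"
      using K u0 by (auto simp: J_def k_def)
    show "free_gamma_K \<alpha> (cauchy_transform \<nu> z) - z = 0" if "z \<in> k ` J" for z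
      using that K by (auto simp: J_def k_def)
  qed (use w in auto)
  then show ?thesis by simp
qed

text \<open>
  The definition of the free cumulant transform names a right inverse on a truncated cone. Reading
  off its values at purely imaginary points is enough, as these already determine \<open>K \<circ> G\<close>.
\<close>

lemma free_gamma_K_inverts_cauchy_transform:
  assumes \<alpha>: "0 < \<alpha>" and fg: "free_gamma \<alpha> \<nu>" and w: "0 < Im w"
  shows "free_gamma_K \<alpha> (cauchy_transform \<nu> w) = w"
proof -
  obtain a \<rho> \<eta> where ct: "characteristic_triplet (gamma_distribution \<alpha>) a \<rho> \<eta>"
    and fct: "free_characteristic_triplet \<nu> a \<rho> \<eta>"
    using fg by (auto simp: free_gamma_def bercovici_pata_def)
  define C where "C z = of_real \<eta> * z + of_real a * z\<^sup>2
      + (CLINT t|\<rho>. 1 / (1 - of_real t * z) - 1 - of_real t * z * indicator {-1..1} t)" for z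
  obtain \<kappa> M where \<kappa>: "0 < \<kappa>" and M: "0 < M" and "free_cumulant_transform_on \<nu> \<kappa> M C"
    using fct by (auto simp: free_characteristic_triplet_def C_def[abs_def])
  then obtain \<kappa>' M' where \<kappa>': "0 < \<kappa>'" "0 < M'"
    and inj: "inj_on (cauchy_transform \<nu>) (truncated_cone \<kappa>' M')"
    and inv: "\<And>z. Im z < 0 \<Longrightarrow> 1 / z \<in> truncated_cone \<kappa> M \<Longrightarrow>
        z \<in> cauchy_transform \<nu> ` truncated_cone \<kappa>' M' \<and>
        C z = z * the_inv_into (truncated_cone \<kappa>' M') (cauchy_transform \<nu>) z - 1"
    unfolding free_cumulant_transform_on_def by blast
  interpret real_distribution \<nu> using fct by (simp add: free_characteristic_triplet_def)
  show ?thesis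
  proof (rule free_gamma_K_right_inverse[OF prob_space_axioms _ M _ w])
    show "sets \<nu> = sets borel" by simp
    fix u :: real assume u: "- 1 / M < u" "u < 0"
    define z where "z = \<i> * complex_of_real u"
    have z: "Im z < 0" "z \<noteq> 0" using u by (auto simp: z_def)
    have "M < - 1 / u" using u M by (simp add: field_simps)
    moreover have "1 / z = \<i> * of_real (- 1 / u)" using u by (simp add: z_def field_simps)
    ultimately have "1 / z \<in> truncated_cone \<kappa> M"
      using M \<kappa> u by (simp add: truncated_cone_def divide_pos_neg del: of_real_divide of_real_minus)
    note inv = inv[OF z(1) this]
    define v where "v = the_inv_into (truncated_cone \<kappa>' M') (cauchy_transform \<nu>) z"
    have Gv: "cauchy_transform \<nu> v = z" and v: "v \<in> truncated_cone \<kappa>' M'"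
      using inv inj by (auto simp: v_def f_the_inv_into_f the_inv_into_into)
    have "C z = z * (of_real \<alpha> * (CLINT x|exp_law. 1 / (1 - z * of_real x)))"
      unfolding C_def using free_cumulant_gamma[OF \<alpha> ct, of z u] by (simp add: z_def mult_ac)
    also have "of_real \<alpha> * (CLINT x|exp_law. 1 / (1 - z * of_real x)) = free_gamma_K \<alpha> z - 1 / z"
      using free_gamma_K_eq[OF z(2), of \<alpha>] by simp
    finally have "z * v = z * free_gamma_K \<alpha> z"
      using inv z by (simp add: v_def right_diff_distrib)
    then have "free_gamma_K \<alpha> z = v" using z by simp
    then show "0 < Im (free_gamma_K \<alpha> (\<i> * of_real u)) \<and>
        cauchy_transform \<nu> (free_gamma_K \<alpha> (\<i> * of_real u)) = \<i> * of_real u"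
      using Gv v by (simp add: z_def truncated_cone_def)
  qed
qed

section \<open>The free Gamma law lives on the positive half-line\<close>

text \<open>
  Multiplication by the conjugate denominator separates real and imaginary parts, with
  \<open>A = \<integral> exp (- x) / \<bar>1 - z x\<bar>\<^sup>2 dx\<close> and \<open>B = \<integral> x exp (- x) / \<bar>1 - z x\<bar>\<^sup>2 dx\<close>.
\<close>

lemma free_gamma_K_decomposition:
  assumes z: "Im z < 0"
  obtains A B where "0 \<le> A" "0 \<le> B"
    "free_gamma_K \<alpha> z = cnj z * of_real (1 / (cmod z)\<^sup>2 - \<alpha> * B) + of_real (\<alpha> * A)"
proof -
  define A B where "A = (LINT x|exp_law. 1 / (cmod (1 - z * of_real x))\<^sup>2)"
    and "B = (LINT x|exp_law. x / (cmod (1 - z * of_real x))\<^sup>2)"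
  have z0: "z \<noteq> 0" using z by auto
  \<comment> \<open>A positive lower bound of \<open>\<bar>1 - z x\<bar>\<close> for all real \<open>x\<close>.\<close>
  define d where "d = cmod z * Im (1 / z)"
  have d: "0 < d" using Im_inverse_pos[OF z] z0 by (simp add: d_def)
  have away: "d \<le> cmod (1 - z * of_real x)" for x
  proof -
    have "1 - z * of_real x = z * (1 / z - of_real x)" using z0 by (simp add: algebra_simps)
    then have "cmod (1 - z * of_real x) = cmod z * cmod (1 / z - of_real x)" by (simp add: norm_mult)
    moreover have "Im (1 / z) \<le> cmod (1 / z - of_real x)"
      using cmod_diff_of_real_ge_Im[of "1 / z" x] by simp
    ultimately show ?thesis by (simp add: d_def mult_left_mono)
  qed
  then have sq: "d\<^sup>2 \<le> (cmod (1 - z * of_real x))\<^sup>2" for x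
    using d by (intro power_mono) auto
  have intA: "integrable exp_law (\<lambda>x. 1 / (cmod (1 - z * of_real x))\<^sup>2)"
  proof (rule exp_law.integrable_const_bound[where B = "1 / d\<^sup>2"])
    show "AE x in exp_law. norm (1 / (cmod (1 - z * of_real x))\<^sup>2) \<le> 1 / d\<^sup>2"
      using sq d by (intro AE_I2) (auto intro!: divide_left_mono mult_pos_pos less_le_trans[OF _ sq])
  qed measurable
  have intB: "integrable exp_law (\<lambda>x. x / (cmod (1 - z * of_real x))\<^sup>2)"
  proof (rule Bochner_Integration.integrable_bound)
    show "integrable exp_law (\<lambda>x. x / d\<^sup>2)"
      using integrable_exp_law_power[of 1] by simp
    show "AE x in exp_law. norm (x / (cmod (1 - z * of_real x))\<^sup>2) \<le> norm (x / d\<^sup>2)"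
      using sq d by (intro AE_I2) (auto intro!: divide_left_mono mult_pos_pos less_le_trans[OF _ sq])
  qed measurable
  have eq: "1 / (1 - z * of_real x) = of_real (1 / (cmod (1 - z * of_real x))\<^sup>2)
      - cnj z * of_real (x / (cmod (1 - z * of_real x))\<^sup>2)" for x
  proof -
    have "1 / (1 - z * of_real x) = cnj (1 - z * of_real x) / of_real ((cmod (1 - z * of_real x))\<^sup>2)"
      using complex_div_cnj[of 1 "1 - z * of_real x"] by simp
    then show ?thesis by (simp add: diff_divide_distrib)
  qed
  have "(CLINT x|exp_law. 1 / (1 - z * of_real x)) = of_real A - cnj z * of_real B"
    unfolding eq A_def B_def using intA intB
    by (simp del: of_real_divide)
  then have "free_gamma_K \<alpha> z = 1 / z + of_real \<alpha> * (of_real A - cnj z * of_real B)"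
    using free_gamma_K_eq[OF z0] by simp
  also have "1 / z = cnj z * of_real (1 / (cmod z)\<^sup>2)"
    using complex_div_cnj[of 1 z] by simp
  finally have "free_gamma_K \<alpha> z = cnj z * of_real (1 / (cmod z)\<^sup>2 - \<alpha> * B) + of_real (\<alpha> * A)"
    by (simp add: algebra_simps)
  moreover have "0 \<le> A" unfolding A_def by (intro integral_nonneg_AE) auto
  moreover have "0 \<le> B" unfolding B_def
    using exp_law_pos by (intro integral_nonneg_AE) (auto elim!: eventually_mono)
  ultimately show thesis using that by blast
qed

text \<open>
  Write \<open>K z = x + \<i> y\<close> and \<open>b = 1 / \<bar>z\<bar>\<^sup>2 - \<alpha> B\<close>, so that \<open>x = Re z b + \<alpha> A\<close> and \<open>y = - Im z b\<close>.
  Since \<open>y > 0\<close>, also \<open>b > 0\<close>. Since \<open>A\<close> is nonnegative, \<open>- x \<le> \<bar>z\<bar> b\<close>, and since \<open>B\<close> is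
  nonnegative, \<open>b \<le> 1 / \<bar>z\<bar>\<^sup>2\<close>, so that \<open>- x \<le> 1 / \<bar>z\<bar>\<close>. The product of the two bounds is
  \<open>x\<^sup>2 \<le> b\<close>.
\<close>

lemma Im_bound_of_free_gamma_K:
  assumes \<alpha>: "0 < \<alpha>" and z: "Im z < 0" and Im: "0 < Im (free_gamma_K \<alpha> z)"
    and Re: "Re (free_gamma_K \<alpha> z) < 0"
  shows "- Im z \<le> Im (free_gamma_K \<alpha> z) / (Re (free_gamma_K \<alpha> z))\<^sup>2"
proof -
  obtain A B where AB: "0 \<le> A" "0 \<le> B"
    "free_gamma_K \<alpha> z = cnj z * of_real (1 / (cmod z)\<^sup>2 - \<alpha> * B) + of_real (\<alpha> * A)"
    using free_gamma_K_decomposition[OF z] by blast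
  define b where "b = 1 / (cmod z)\<^sup>2 - \<alpha> * B"
  define x y where "x = Re (free_gamma_K \<alpha> z)" and "y = Im (free_gamma_K \<alpha> z)"
  have x: "x = Re z * b + \<alpha> * A" and y: "y = - Im z * b"
    unfolding x_def y_def AB(3) b_def[symmetric] by simp_all
  have b: "0 < b" using y Im z unfolding y_def[symmetric] by (auto simp: mult_less_0_iff)
  have r: "0 < cmod z" using z by auto
  have "Re z * b \<le> x" using x AB \<alpha> by simp
  then have xb: "- x \<le> - Re z * b" by simp
  also have "\<dots> \<le> cmod z * b"
    using abs_Re_le_cmod[of z] b by (intro mult_right_mono) auto
  finally have xr: "- x \<le> cmod z * b" .
  also have "\<dots> \<le> cmod z * (1 / (cmod z)\<^sup>2)"
    using AB \<alpha> r by (intro mult_left_mono) (auto simp: b_def)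
  also have "\<dots> = 1 / cmod z" using r by (simp add: power2_eq_square)
  finally have "- x \<le> 1 / cmod z" .
  moreover have x0: "x < 0" using Re by (simp add: x_def)
  ultimately have "(- x) * (- x) \<le> (cmod z * b) * (1 / cmod z)"
    using xr by (intro mult_mono) auto
  then have "x\<^sup>2 \<le> b" using r by (simp add: power2_eq_square)
  then have "- Im z * x\<^sup>2 \<le> y" using z unfolding y by (intro mult_left_mono) auto
  then show ?thesis using x0 unfolding x_def[symmetric] y_def[symmetric] by (simp add: le_divide_eq)
qed

text \<open>
  On an interval of radius \<open>h\<close> around \<open>x\<close> the Poisson kernel at height \<open>h\<close> is at least
  \<open>1 / (2 h)\<close>, so the hypothesis bounds the mass of that interval by a multiple of \<open>h\<^sup>2\<close>. Hence
  the distribution function has derivative \<open>0\<close> on the negative half-line, is constant there, and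
  the constant is its limit at \<open>- \<infinity>\<close>.
\<close>

lemma prob_measure_nonneg_of_Im_bound:
  assumes "real_distribution \<nu>"
    and bound: "\<And>x y. x < 0 \<Longrightarrow> 0 < y \<Longrightarrow> - Im (cauchy_transform \<nu> (Complex x y)) \<le> y / x\<^sup>2"
  shows "AE t in \<nu>. 0 \<le> t"
proof -
  interpret real_distribution \<nu> by fact
  have sets: "sets \<nu> = sets borel" by simp
  have small: "measure \<nu> {x - h .. x + h} \<le> 2 / x\<^sup>2 * h\<^sup>2" if "x < 0" "0 < h" for x h
  proof -
    let ?f = "\<lambda>t. h / (cmod (Complex x h - of_real t))\<^sup>2"
    have "measure \<nu> {x - h .. x + h} * (1 / (2 * h)) = (LINT t|\<nu>. indicator {x - h .. x + h} t * (1 / (2 * h)))"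
      by simp
    also have "\<dots> \<le> (LINT t|\<nu>. ?f t)"
    proof (rule integral_mono)
      show "integrable \<nu> ?f" using Im_cauchy_transform(2)[OF prob_space_axioms sets, of "Complex x h"] that by simp
      show "indicator {x - h .. x + h} t * (1 / (2 * h)) \<le> ?f t" for t
      proof (cases "t \<in> {x - h .. x + h}")
        case True
        then have "\<bar>x - t\<bar> \<le> h" by auto
        then have "(x - t)\<^sup>2 \<le> h\<^sup>2" using that by (metis abs_le_square_iff abs_of_pos)
        then have "(cmod (Complex x h - of_real t))\<^sup>2 \<le> 2 * h\<^sup>2"
          by (simp add: cmod_power2)
        moreover have "0 < (cmod (Complex x h - of_real t))\<^sup>2"
          using that by (simp add: cmod_power2 add_nonneg_pos)
        ultimately have "h / (2 * h\<^sup>2) \<le> ?f t"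
          using that by (intro divide_left_mono) auto
        with True that show ?thesis by (simp add: power2_eq_square)
      qed (use that in simp)
      show "integrable \<nu> (\<lambda>t. indicator {x - h .. x + h} t * (1 / (2 * h)))"
        by (intro integrable_mult_left integrable_real_indicator) (auto simp: emeasure_eq_measure)
    qed
    also have "\<dots> \<le> h / x\<^sup>2"
      using bound[OF that] Im_cauchy_transform(1)[OF prob_space_axioms sets, of "Complex x h"] that by simp
    finally show ?thesis using that by (simp add: field_simps power2_eq_square)
  qed
  have deriv: "(cdf \<nu> has_derivative (\<lambda>h. 0)) (at x)" if "x < 0" for x
  proof (rule has_derivative_of_quadratic_remainder[where \<delta> = 1 and C = "2 / x\<^sup>2"])
    fix h :: real
    have le: "\<bar>cdf \<nu> (x + h) - cdf \<nu> x\<bar> \<le> measure \<nu> {x - \<bar>h\<bar> .. x + \<bar>h\<bar>}"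
    proof (cases "0 \<le> h")
      case True
      then have "cdf \<nu> (x + h) - cdf \<nu> x = measure \<nu> {x <.. x + h}"
        by (cases "h = 0") (auto simp: cdf_diff_eq)
      also have "\<dots> \<le> measure \<nu> {x - \<bar>h\<bar> .. x + \<bar>h\<bar>}"
        using True by (intro finite_measure_mono) auto
      finally show ?thesis using True cdf_nondecreasing[of x "x + h"] by simp
    next
      case False
      then have "cdf \<nu> x - cdf \<nu> (x + h) = measure \<nu> {x + h <.. x}"
        by (intro cdf_diff_eq) auto
      also have "\<dots> \<le> measure \<nu> {x - \<bar>h\<bar> .. x + \<bar>h\<bar>}"
        using False by (intro finite_measure_mono) auto
      finally show ?thesis using False cdf_nondecreasing[of "x + h" x] by simp
    qed
    show "norm (cdf \<nu> (x + h) - cdf \<nu> x - 0) \<le> 2 / x\<^sup>2 * (norm h)\<^sup>2"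
    proof (cases "h = 0")
      case False
      then show ?thesis using le small[OF that, of "\<bar>h\<bar>"] by simp
    qed simp
  qed simp_all
  have "\<exists>c. \<forall>x\<in>{..<0}. cdf \<nu> x = c"
    by (rule has_derivative_zero_constant) (auto intro: has_derivative_at_withinI deriv)
  then obtain c where c: "\<And>x. x < 0 \<Longrightarrow> cdf \<nu> x = c" by auto
  have "eventually (\<lambda>x. cdf \<nu> x = c) at_bot"
    using eventually_gt_at_bot[of "0::real"] eventually_at_bot_dense c by blast
  from tendsto_cong[OF this] have "((\<lambda>_. c) \<longlongrightarrow> 0) (at_bot :: real filter)"
    using cdf_lim_at_bot by simp
  then have "c = 0" by (simp add: tendsto_const_iff)
  have "AE t in \<nu>. \<forall>n::nat. \<not> t \<le> - 1 / real (Suc n)"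
    unfolding AE_all_countable
  proof
    fix n
    have "measure \<nu> {.. - 1 / real (Suc n)} = 0"
      using c[of "- 1 / real (Suc n)"] \<open>c = 0\<close> by (simp add: cdf_def)
    then have "{.. - 1 / real (Suc n)} \<in> null_sets \<nu>"
      by (auto simp: null_sets_def emeasure_eq_measure)
    from AE_not_in[OF this] show "AE t in \<nu>. \<not> t \<le> - 1 / real (Suc n)" by simp
  qed
  then show ?thesis
  proof eventually_elim
    case (elim t)
    show "0 \<le> t"
    proof (rule ccontr)
      assume "\<not> 0 \<le> t"
      then obtain n where "inverse (real (Suc n)) < - t" using reals_Archimedean[of "- t"] by auto
      then have "t \<le> - 1 / real (Suc n)" by (simp add: inverse_eq_divide)
      with elim show False by blast
    qed
  qed
qed

lemma free_gamma_nonneg: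
  assumes \<alpha>: "0 < \<alpha>" and fg: "free_gamma \<alpha> \<nu>"
  shows "AE t in \<nu>. 0 \<le> t"
proof -
  have rd: "real_distribution \<nu>"
    using fg by (auto simp: free_gamma_def bercovici_pata_def free_characteristic_triplet_def)
  then interpret real_distribution \<nu> .
  show ?thesis
  proof (rule prob_measure_nonneg_of_Im_bound[OF rd])
    fix x y :: real assume xy: "x < 0" "0 < y"
    let ?z = "cauchy_transform \<nu> (Complex x y)"
    have "Im ?z < 0"
      using xy by (intro Im_cauchy_transform(3)[OF prob_space_axioms]) auto
    moreover have "free_gamma_K \<alpha> ?z = Complex x y"
      using xy by (intro free_gamma_K_inverts_cauchy_transform[OF \<alpha> fg]) simp
    ultimately show "- Im ?z \<le> y / x\<^sup>2"
      using Im_bound_of_free_gamma_K[OF \<alpha>, of ?z] xy by simp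
  qed
qed

section \<open>Stieltjes transforms\<close>

text \<open>
  For a measure on the positive half-line this is, up to a change of variable, the Stieltjes
  transform of \<open>t^n M(dt)\<close>; at \<open>s = 0\<close> it is the \<open>n\<close>-th moment.
\<close>

definition stieltjes :: "real measure \<Rightarrow> nat \<Rightarrow> real \<Rightarrow> real" where
  "stieltjes M n s = (LINT t|M. t ^ n / (1 + s * t))"

context
  fixes M :: "real measure"
  assumes sets_M [measurable_cong]: "sets M = sets borel"
    and fin: "finite_measure M"
    and nonneg: "AE t in M. 0 \<le> t"
begin

lemma integrable_stieltjes_0:
  assumes "0 < s"
  shows "integrable M (\<lambda>t. 1 / (1 + s * t))"
  using fin nonneg assms
  by (intro finite_measure.integrable_const_bound[where B = 1])
     (auto elim!: eventually_mono simp: divide_le_eq add_nonneg_nonneg)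

lemma integrable_stieltjes_Suc:
  assumes "0 < s" "integrable M (\<lambda>t. t ^ n)"
  shows "integrable M (\<lambda>t. t ^ Suc n / (1 + s * t))"
proof (rule Bochner_Integration.integrable_bound)
  show "integrable M (\<lambda>t. t ^ n / s)" using assms by simp
  show "AE t in M. norm (t ^ Suc n / (1 + s * t)) \<le> norm (t ^ n / s)"
    using nonneg
  proof eventually_elim
    case (elim t)
    have "t ^ Suc n / (1 + s * t) = t ^ n * (t / (1 + s * t))" by simp
    also have "\<dots> \<le> t ^ n * (1 / s)"
      using elim \<open>0 < s\<close> by (intro mult_left_mono) (auto simp: field_simps add_pos_nonneg)
    finally show ?case using elim \<open>0 < s\<close> by (simp add: add_nonneg_nonneg)
  qed
qed simp

text \<open>
  This is \<open>t^n - t^n / (1 + s t) = s t^(n + 1) / (1 + s t)\<close>, integrated: taking difference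
  quotients at \<open>0\<close> raises the index.
\<close>

lemma stieltjes_diff:
  assumes "0 < s" "integrable M (\<lambda>t. t ^ n)"
  shows "((LINT t|M. t ^ n) - stieltjes M n s) / s = stieltjes M (Suc n) s"
proof -
  have int: "integrable M (\<lambda>t. s * (t ^ Suc n / (1 + s * t)))"
    using integrable_stieltjes_Suc[OF assms] by (rule integrable_mult_right)
  have eq: "t ^ n / (1 + s * t) = t ^ n - s * (t ^ Suc n / (1 + s * t))" if "0 \<le> t" for t
  proof -
    have "0 < 1 + s * t" using that \<open>0 < s\<close> by (simp add: add_pos_nonneg)
    then show ?thesis by (simp add: field_simps)
  qed
  have "stieltjes M n s = (LINT t|M. t ^ n - s * (t ^ Suc n / (1 + s * t)))"
    unfolding stieltjes_def by (rule integral_cong_AE) (use nonneg in \<open>auto elim!: eventually_mono simp: eq\<close>)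
  also have "\<dots> = (LINT t|M. t ^ n) - (LINT t|M. s * (t ^ Suc n / (1 + s * t)))"
    by (rule Bochner_Integration.integral_diff[OF assms(2) int])
  also have "\<dots> = (LINT t|M. t ^ n) - s * stieltjes M (Suc n) s"
    unfolding stieltjes_def integral_mult_right_zero by (rule refl)
  finally show ?thesis using assms by simp
qed

text \<open>
  Monotone convergence: the integrands increase to \<open>t^n\<close> as \<open>s\<close> decreases to \<open>0\<close>. Convergence of
  the transform at \<open>0\<close> thus yields the existence of the moment together with its value.
\<close>

lemma moment_of_stieltjes_limit:
  assumes int: "\<And>s. 0 < s \<Longrightarrow> integrable M (\<lambda>t. t ^ n / (1 + s * t))"
    and lim: "(stieltjes M n \<longlongrightarrow> c) (at_right 0)"
  shows "integrable M (\<lambda>t. t ^ n)" "(LINT t|M. t ^ n) = c"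
proof -
  define f where "f k t = t ^ n / (1 + 1 / real (Suc k) * t)" for k t
  have fint: "integrable M (f k)" for k
    unfolding f_def[abs_def] by (rule int) simp
  have flim: "AE t in M. (\<lambda>k. f k t) \<longlonglongrightarrow> t ^ n"
  proof (rule AE_I2)
    fix t :: real
    have "(\<lambda>k. t ^ n / (1 + 1 / real (Suc k) * t)) \<longlonglongrightarrow> t ^ n / (1 + 0 * t)"
      using LIMSEQ_inverse_real_of_nat by (intro tendsto_intros) (auto simp: inverse_eq_divide)
    then show "(\<lambda>k. f k t) \<longlonglongrightarrow> t ^ n" by (simp add: f_def)
  qed
  have mono: "AE t in M. mono (\<lambda>k. f k t)"
    using nonneg
  proof eventually_elim
    case (elim t)
    then show ?case
      unfolding f_def by (intro monoI divide_left_mono) 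
        (auto intro!: mult_pos_pos add_pos_nonneg add_left_mono mult_right_mono divide_left_mono)
  qed
  have "filterlim (\<lambda>k. 1 / real (Suc k)) (at_right 0) sequentially"
    using LIMSEQ_inverse_real_of_nat
    by (auto simp: filterlim_at inverse_eq_divide)
  from filterlim_compose[OF lim this] have "(\<lambda>k. integral\<^sup>L M (f k)) \<longlonglongrightarrow> c"
    by (simp add: f_def[abs_def] stieltjes_def)
  note * = fint mono flim this
  show "integrable M (\<lambda>t. t ^ n)" "(LINT t|M. t ^ n) = c"
    using integrable_monotone_convergence[OF *] integral_monotone_convergence[OF *] by auto
qed

end

lemma stieltjes_exp_law_diff:
  "0 < s \<Longrightarrow> ((LINT t|exp_law. t ^ n) - stieltjes exp_law n s) / s = stieltjes exp_law (Suc n) s"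
  using exp_law_pos
  by (intro stieltjes_diff sets_exp_law exp_law.finite_measure_axioms integrable_exp_law_power)
     (auto elim: eventually_mono)

lemma integrable_stieltjes_exp_law:
  assumes "0 \<le> s"
  shows "integrable exp_law (\<lambda>t. t ^ n / (1 + s * t))"
proof (rule Bochner_Integration.integrable_bound[OF integrable_exp_law_power[of n]])
  show "AE t in exp_law. norm (t ^ n / (1 + s * t)) \<le> norm (t ^ n)"
    using exp_law_pos
  proof eventually_elim
    case (elim t)
    then have "1 \<le> 1 + s * t" using assms by simp
    with elim show ?case by (simp add: divide_le_eq mult_left_le)
  qed
qed simp

lemma stieltjes_exp_law_bounds:
  assumes "0 \<le> s"
  shows "0 \<le> stieltjes exp_law n s" "stieltjes exp_law n s \<le> (LINT t|exp_law. t ^ n)"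
proof -
  show "0 \<le> stieltjes exp_law n s"
    unfolding stieltjes_def using exp_law_pos assms
    by (intro integral_nonneg_AE) (auto elim!: eventually_mono simp: add_nonneg_nonneg)
  show "stieltjes exp_law n s \<le> (LINT t|exp_law. t ^ n)"
    unfolding stieltjes_def
  proof (rule integral_mono_AE[OF integrable_stieltjes_exp_law[OF assms] integrable_exp_law_power])
    show "AE t in exp_law. t ^ n / (1 + s * t) \<le> t ^ n"
      using exp_law_pos
    proof eventually_elim
      case (elim t)
      then have "1 \<le> 1 + s * t" using assms by simp
      with elim show ?case by (simp add: divide_le_eq mult_left_le)
    qed
  qed
qed

lemma stieltjes_exp_law_tendsto:
  "(stieltjes exp_law n \<longlongrightarrow> (LINT t|exp_law. t ^ n)) (at_right 0)"
proof -
  let ?m = "\<lambda>n. LINT t|exp_law. t ^ n"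
  have low: "?m n - s * ?m (Suc n) \<le> stieltjes exp_law n s" if "0 < s" for s
    using stieltjes_exp_law_diff[OF that, of n] stieltjes_exp_law_bounds(2)[of s "Suc n"] that
    by (simp add: field_simps)
  have "((\<lambda>s. ?m n - s * ?m (Suc n)) \<longlongrightarrow> ?m n - 0 * ?m (Suc n)) (at_right 0)"
    by (intro tendsto_intros)
  then have lim: "((\<lambda>s. ?m n - s * ?m (Suc n)) \<longlongrightarrow> ?m n) (at_right 0)" by simp
  show ?thesis
  proof (rule tendsto_sandwich[OF _ _ lim tendsto_const])
    show "\<forall>\<^sub>F s in at_right 0. ?m n - s * ?m (Suc n) \<le> stieltjes exp_law n s"
      by (rule eventually_at_right_0I) (rule low)
    show "\<forall>\<^sub>F s in at_right 0. stieltjes exp_law n s \<le> ?m n"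
      by (rule eventually_at_right_0I) (simp add: stieltjes_exp_law_bounds)
  qed
qed

text \<open>
  The identity \<open>K (G w) = w\<close> at the boundary point \<open>w = - 1 / s\<close>, where \<open>G w = - s g\<close> with
  \<open>g = stieltjes \<nu> 0 s\<close>. The measure is carried by the positive half-line, so \<open>G\<close> is continuous at
  this point, and \<open>K\<close> is continuous at \<open>- s g < 0\<close>.
\<close>

lemma stieltjes_equation:
  assumes \<nu>: "prob_space \<nu>" "sets \<nu> = sets borel" "AE t in \<nu>. 0 \<le> t"
    and K: "\<And>w. 0 < Im w \<Longrightarrow> free_gamma_K \<alpha> (cauchy_transform \<nu> w) = w"
    and s: "0 < s"
  shows "1 - stieltjes \<nu> 0 s = \<alpha> * s * stieltjes \<nu> 0 s * stieltjes exp_law 0 (s * stieltjes \<nu> 0 s)"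
proof -
  interpret prob_space \<nu> by fact
  note [measurable_cong] = \<nu>(2)
  define g where "g = stieltjes \<nu> 0 s"
  have int: "integrable \<nu> (\<lambda>t. 1 / (1 + s * t))"
    by (rule integrable_stieltjes_0[OF \<nu>(2) finite_measure_axioms \<nu>(3) s])
  have nn: "AE t in \<nu>. 0 \<le> 1 / (1 + s * t)"
    using \<nu>(3) s by (auto elim!: eventually_mono simp: add_nonneg_nonneg)
  have g: "0 < g"
  proof -
    have "g \<noteq> 0"
    proof
      assume "g = 0"
      then have "AE t in \<nu>. 1 / (1 + s * t) = 0"
        using integral_nonneg_eq_0_iff_AE[OF int nn] by (simp add: g_def stieltjes_def)
      with \<nu>(3) have "AE t in \<nu>. False"
      proof eventually_elim
        case (elim t)
        have "0 < 1 + s * t" using s elim(1) by (simp add: add_pos_nonneg)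
        moreover have "1 + s * t = 0" using elim by simp
        ultimately show ?case by linarith
      qed
      then show False by simp
    qed
    moreover have "0 \<le> g"
      unfolding g_def stieltjes_def using nn by (intro integral_nonneg_AE) simp
    ultimately show ?thesis by simp
  qed
  define x where "x = - 1 / s"
  have x: "x < 0" using s by (simp add: x_def)
  have G: "cauchy_transform \<nu> (of_real x) = of_real (- s * g)"
  proof -
    have eq: "1 / (of_real x - of_real t :: complex) = of_real (- s * (1 / (1 + s * t)))" if "0 \<le> t" for t
    proof -
      have "0 < 1 + s * t" using s that by (simp add: add_pos_nonneg)
      then have "1 / (x - t) = - s * (1 / (1 + s * t))" using s by (simp add: x_def field_simps)
      then show ?thesis by (metis of_real_1 of_real_diff of_real_divide)
    qed
    have L: "(LINT t|\<nu>. - s * (1 / (1 + s * t))) = - s * g"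
      unfolding g_def stieltjes_def by (subst integral_mult_right_zero) simp
    have "cauchy_transform \<nu> (of_real x) = (CLINT t|\<nu>. of_real (- s * (1 / (1 + s * t))))"
      unfolding cauchy_transform_def
      by (rule integral_cong_AE) (use \<nu>(3) eq in \<open>auto elim!: eventually_mono\<close>)
    also have "\<dots> = of_real (LINT t|\<nu>. - s * (1 / (1 + s * t)))"
      by (rule integral_complex_of_real)
    also have "\<dots> = of_real (- s * g)"
      by (simp only: L)
    finally show ?thesis .
  qed
  let ?w = "\<lambda>y::real. of_real x + \<i> * of_real y"
  have w: "(?w \<longlongrightarrow> of_real x) (at_right 0)"
  proof -
    have "(?w \<longlongrightarrow> of_real x + \<i> * of_real 0) (at_right 0)" by (intro tendsto_intros)
    then show ?thesis by simp
  qed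
  have G_lim: "((\<lambda>y. cauchy_transform \<nu> (?w y)) \<longlongrightarrow> of_real (- s * g)) (at_right 0)"
    using isCont_tendsto_compose[OF isCont_cauchy_transform[OF finite_measure_axioms \<nu>(2,3) x] w] G by simp
  have Kc: "isCont (free_gamma_K \<alpha>) (of_real (- s * g))"
  proof -
    define c :: complex where "c = of_real (- s * g)"
    have c: "c \<noteq> 0" using s g by (simp add: c_def)
    have "1 / c = of_real (1 / (- s * g))" by (simp add: c_def)
    moreover have "isCont (cauchy_transform exp_law) (of_real (1 / (- s * g)))"
    proof (rule isCont_cauchy_transform)
      show "AE t in exp_law. 0 \<le> t" using exp_law_pos by eventually_elim simp
      show "1 / (- s * g) < 0" using s g by (simp add: mult_pos_pos)
    qed (simp_all add: exp_law.finite_measure_axioms)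
    ultimately have G_cont: "isCont (cauchy_transform exp_law) (1 / c)" by simp
    have "isCont (\<lambda>z. 1 / z) c"
      by (intro isCont_divide continuous_const continuous_ident c)
    from isCont_o2[OF this G_cont] have "isCont (\<lambda>z. 1 / z + of_real \<alpha> / z * cauchy_transform exp_law (1 / z)) c"
      by (intro isCont_add isCont_mult isCont_divide continuous_const continuous_ident c)
    then show ?thesis unfolding free_gamma_K_def[abs_def] c_def .
  qed
  have "((\<lambda>y. free_gamma_K \<alpha> (cauchy_transform \<nu> (?w y))) \<longlongrightarrow> free_gamma_K \<alpha> (of_real (- s * g))) (at_right 0)"
    by (rule isCont_tendsto_compose[OF Kc G_lim])
  moreover have "\<forall>\<^sub>F y in at_right 0. free_gamma_K \<alpha> (cauchy_transform \<nu> (?w y)) = ?w y"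
    by (rule eventually_at_right_0I) (simp add: K)
  ultimately have "(?w \<longlongrightarrow> free_gamma_K \<alpha> (of_real (- s * g))) (at_right 0)"
    by (rule Lim_transform_eventually)
  from tendsto_unique[OF _ w this] have "of_real x = free_gamma_K \<alpha> (of_real (- s * g))" by simp
  also have "\<dots> = of_real (1 / (- s * g) + \<alpha> * stieltjes exp_law 0 (s * g))"
  proof -
    have "(CLINT t|exp_law. 1 / (1 - of_real (- s * g) * of_real t))
        = (CLINT t|exp_law. of_real (t ^ 0 / (1 + s * g * t)))"
      by (intro Bochner_Integration.integral_cong) auto
    also have "\<dots> = of_real (stieltjes exp_law 0 (s * g))"
      unfolding integral_complex_of_real stieltjes_def ..
    finally show ?thesis using s g by (subst free_gamma_K_eq) auto
  qed
  finally have "x = 1 / (- s * g) + \<alpha> * stieltjes exp_law 0 (s * g)"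
    by (simp only: of_real_eq_iff)
  then show ?thesis unfolding g_def[symmetric] using s g
    by (simp add: x_def field_simps)
qed

section \<open>Expansions that are uniform in the parameter\<close>

text \<open>
  The value \<open>0\<close> of the parameter is part of the family, so that the limiting object and its
  coefficients are treated together with the approximating ones.
\<close>

definition limit_family :: "(real \<Rightarrow> real \<Rightarrow> real) \<Rightarrow> (real \<Rightarrow> real) \<Rightarrow> bool" where
  "limit_family h c \<longleftrightarrow> (\<forall>\<alpha>\<ge>0. (h \<alpha> \<longlongrightarrow> c \<alpha>) (at_right 0)) \<and> (c \<longlongrightarrow> c 0) (at_right 0)"

text \<open>
  A family is expandable of order \<open>n\<close> if it and its first \<open>n\<close> iterated difference quotients at
  \<open>s = 0\<close> have limits, all of them continuous in the parameter at \<open>0\<close>. Up to sign the limits are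
  the coefficients of an asymptotic expansion in \<open>s\<close>.
\<close>

primrec expandable :: "nat \<Rightarrow> (real \<Rightarrow> real \<Rightarrow> real) \<Rightarrow> bool" where
  "expandable 0 h = (\<exists>c. limit_family h c)"
| "expandable (Suc n) h = (\<exists>c. limit_family h c \<and> expandable n (\<lambda>\<alpha> s. (c \<alpha> - h \<alpha> s) / s))"

lemma limit_family_cong:
  assumes "\<And>\<alpha> s. 0 \<le> \<alpha> \<Longrightarrow> 0 < s \<Longrightarrow> h \<alpha> s = k \<alpha> s"
  shows "limit_family h c \<longleftrightarrow> limit_family k c"
proof -
  have "(h \<alpha> \<longlongrightarrow> c \<alpha>) (at_right 0) \<longleftrightarrow> (k \<alpha> \<longlongrightarrow> c \<alpha>) (at_right 0)" if "0 \<le> \<alpha>" for \<alpha>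
    using that by (intro tendsto_cong) (auto intro!: eventually_at_right_0I simp: assms)
  then show ?thesis by (simp add: limit_family_def)
qed

lemma expandable_cong:
  assumes "\<And>\<alpha> s. 0 \<le> \<alpha> \<Longrightarrow> 0 < s \<Longrightarrow> h \<alpha> s = k \<alpha> s"
  shows "expandable n h \<longleftrightarrow> expandable n k"
  using assms
proof (induction n arbitrary: h k)
  case 0
  then show ?case using limit_family_cong[of h k] by simp
next
  case (Suc n)
  have "expandable n (\<lambda>\<alpha> s. (c \<alpha> - h \<alpha> s) / s) \<longleftrightarrow> expandable n (\<lambda>\<alpha> s. (c \<alpha> - k \<alpha> s) / s)" for c
    by (rule Suc.IH) (simp add: Suc.prems)
  then show ?case using limit_family_cong[of h k] Suc.prems by simp
qed

lemma expandable_transfer: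
  assumes "expandable n k" "\<And>\<alpha> s. 0 \<le> \<alpha> \<Longrightarrow> 0 < s \<Longrightarrow> h \<alpha> s = k \<alpha> s"
  shows "expandable n h"
  using assms(1) expandable_cong[of h k n, OF assms(2)] by simp

lemma expandable_0: "expandable n h \<Longrightarrow> \<exists>c. limit_family h c"
  by (cases n) auto

lemma expandable_Suc_D: "expandable (Suc n) h \<Longrightarrow> expandable n h"
proof (induction n arbitrary: h)
  case (Suc n)
  then show ?case by (auto simp del: expandable.simps(1))
qed auto

lemma expandable_const:
  assumes "(c \<longlongrightarrow> c 0) (at_right 0)"
  shows "expandable n (\<lambda>\<alpha> s. c \<alpha>)"
  using assms
proof (induction n arbitrary: c)
  case 0
  then show ?case by (auto simp: limit_family_def)
next
  case (Suc n)
  have "expandable n (\<lambda>\<alpha> s. 0)" by (rule Suc.IH) simp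
  then have "expandable n (\<lambda>\<alpha> s. (c \<alpha> - c \<alpha>) / s)"
    by (rule expandable_transfer) simp
  moreover have "limit_family (\<lambda>\<alpha> s. c \<alpha>) c" using Suc.prems by (simp add: limit_family_def)
  ultimately show ?case unfolding expandable.simps by blast
qed

lemma expandable_add:
  assumes "expandable n h" "expandable n k"
  shows "expandable n (\<lambda>\<alpha> s. h \<alpha> s + k \<alpha> s)"
  using assms
proof (induction n arbitrary: h k)
  case 0
  then obtain c d where "limit_family h c" "limit_family k d" by auto
  then have "limit_family (\<lambda>\<alpha> s. h \<alpha> s + k \<alpha> s) (\<lambda>\<alpha>. c \<alpha> + d \<alpha>)"
    by (auto simp: limit_family_def intro!: tendsto_add)
  then show ?case by auto
next
  case (Suc n)
  then obtain c d where cd: "limit_family h c" "limit_family k d"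
    and D: "expandable n (\<lambda>\<alpha> s. (c \<alpha> - h \<alpha> s) / s)" "expandable n (\<lambda>\<alpha> s. (d \<alpha> - k \<alpha> s) / s)"
    by auto
  have "limit_family (\<lambda>\<alpha> s. h \<alpha> s + k \<alpha> s) (\<lambda>\<alpha>. c \<alpha> + d \<alpha>)"
    using cd by (auto simp: limit_family_def intro!: tendsto_add)
  moreover have "expandable n (\<lambda>\<alpha> s. (c \<alpha> + d \<alpha> - (h \<alpha> s + k \<alpha> s)) / s)"
    using Suc.IH[OF D] by (rule expandable_transfer) (simp add: field_simps)
  ultimately show ?case by auto
qed

text \<open>
  The product rule \<open>D (h k) = D h * k + h(0+) * D k\<close>.
\<close>

lemma expandable_mult:
  assumes "expandable n h" "expandable n k"
  shows "expandable n (\<lambda>\<alpha> s. h \<alpha> s * k \<alpha> s)"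
  using assms
proof (induction n arbitrary: h k)
  case 0
  then obtain c d where "limit_family h c" "limit_family k d" by auto
  then have "limit_family (\<lambda>\<alpha> s. h \<alpha> s * k \<alpha> s) (\<lambda>\<alpha>. c \<alpha> * d \<alpha>)"
    by (auto simp: limit_family_def intro!: tendsto_mult)
  then show ?case by auto
next
  case (Suc n)
  then obtain c d where cd: "limit_family h c" "limit_family k d"
    and D: "expandable n (\<lambda>\<alpha> s. (c \<alpha> - h \<alpha> s) / s)" "expandable n (\<lambda>\<alpha> s. (d \<alpha> - k \<alpha> s) / s)"
    by auto
  have "limit_family (\<lambda>\<alpha> s. h \<alpha> s * k \<alpha> s) (\<lambda>\<alpha>. c \<alpha> * d \<alpha>)"
    using cd by (auto simp: limit_family_def intro!: tendsto_mult)
  moreover have "expandable n (\<lambda>\<alpha> s. c \<alpha>)"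
    using cd by (intro expandable_const) (simp add: limit_family_def)
  have "expandable n (\<lambda>\<alpha> s. (c \<alpha> * d \<alpha> - h \<alpha> s * k \<alpha> s) / s)"
  proof (rule expandable_transfer)
    show "expandable n (\<lambda>\<alpha> s. (c \<alpha> - h \<alpha> s) / s * k \<alpha> s + c \<alpha> * ((d \<alpha> - k \<alpha> s) / s))"
      using D \<open>expandable n (\<lambda>\<alpha> s. c \<alpha>)\<close> expandable_Suc_D[OF Suc.prems(2)]
      by (intro expandable_add Suc.IH)
  qed (simp add: field_simps)
  ultimately show ?case by auto
qed

text \<open>
  The chain rule: the difference quotient of \<open>stieltjes exp_law j (s g)\<close> is \<open>g\<close> times the same
  expression with \<open>j + 1\<close>, so the induction runs over all indices \<open>j\<close> at once.
\<close>

lemma expandable_stieltjes_comp: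
  assumes "expandable n g"
    and pos: "\<And>\<alpha> s. 0 \<le> \<alpha> \<Longrightarrow> 0 < s \<Longrightarrow> 0 < g \<alpha> s"
  shows "expandable n (\<lambda>\<alpha> s. stieltjes exp_law j (s * g \<alpha> s))"
  using assms(1)
proof (induction n arbitrary: j)
  have conv: "limit_family (\<lambda>\<alpha> s. stieltjes exp_law j (s * g \<alpha> s)) (\<lambda>_. LINT t|exp_law. t ^ j)"
    if "expandable m g" for m j
  proof -
    obtain c where c: "limit_family g c" using expandable_0[OF \<open>expandable m g\<close>] by auto
    have "filterlim (\<lambda>s. s * g \<alpha> s) (at_right 0) (at_right 0)" if "0 \<le> \<alpha>" for \<alpha>
    proof -
      have "((\<lambda>s. s * g \<alpha> s) \<longlongrightarrow> 0 * c \<alpha>) (at_right 0)"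
        using c that by (intro tendsto_intros) (auto simp: limit_family_def)
      moreover have "\<forall>\<^sub>F s in at_right 0. s * g \<alpha> s \<in> {0<..}"
        using pos that by (auto intro!: eventually_at_right_0I)
      ultimately show ?thesis
        by (auto simp: filterlim_at elim!: eventually_mono)
    qed
    then show ?thesis
      unfolding limit_family_def by (auto intro: filterlim_compose[OF stieltjes_exp_law_tendsto])
  qed
  {
    case 0
    then show ?case using conv by fastforce
  next
    case (Suc n)
    have "expandable n (\<lambda>\<alpha> s. g \<alpha> s * stieltjes exp_law (Suc j) (s * g \<alpha> s))"
      using expandable_Suc_D[OF Suc.prems] by (intro expandable_mult Suc.IH)
    moreover have "((LINT t|exp_law. t ^ j) - stieltjes exp_law j (s * g \<alpha> s)) / s
        = g \<alpha> s * stieltjes exp_law (Suc j) (s * g \<alpha> s)" if "0 \<le> \<alpha>" "0 < s" for \<alpha> s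
      using stieltjes_exp_law_diff[of "s * g \<alpha> s" j] pos[OF that] that by (simp add: field_simps)
    ultimately have "expandable n
        (\<lambda>\<alpha> s. ((LINT t|exp_law. t ^ j) - stieltjes exp_law j (s * g \<alpha> s)) / s)"
      by (rule expandable_transfer)
    then show ?case using conv[OF Suc.prems] by auto
  }
qed

text \<open>
  The difference quotient of \<open>g\<close> is \<open>\<alpha> F\<close>, so an expansion of \<open>F\<close> of order \<open>n\<close> gives one of \<open>g\<close> of
  order \<open>n + 1\<close>, which the fixed-point equation passes back to \<open>F\<close>. The bounds on \<open>g\<close> start the
  induction: they keep \<open>F\<close> bounded, hence \<open>g\<close> tends to \<open>1\<close>.
\<close>

lemma expandable_fixed_point:
  assumes fp: "\<And>\<alpha> s. 0 \<le> \<alpha> \<Longrightarrow> 0 < s \<Longrightarrow> F \<alpha> s = g \<alpha> s * stieltjes exp_law 0 (s * g \<alpha> s)"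
    and g: "\<And>\<alpha> s. 0 \<le> \<alpha> \<Longrightarrow> 0 < s \<Longrightarrow> g \<alpha> s = 1 - \<alpha> * s * F \<alpha> s"
    and pos: "\<And>\<alpha> s. 0 \<le> \<alpha> \<Longrightarrow> 0 < s \<Longrightarrow> 0 < g \<alpha> s"
    and le: "\<And>\<alpha> s. 0 \<le> \<alpha> \<Longrightarrow> 0 < s \<Longrightarrow> g \<alpha> s \<le> 1"
  shows "expandable n F"
proof -
  have F: "expandable n F" if "expandable n g" for n
  proof -
    have "expandable n (\<lambda>\<alpha> s. g \<alpha> s * stieltjes exp_law 0 (s * g \<alpha> s))"
      using that pos by (intro expandable_mult expandable_stieltjes_comp)
    then show ?thesis by (rule expandable_transfer) (rule fp)
  qed
  have bound: "\<bar>F \<alpha> s\<bar> \<le> 1" if "0 \<le> \<alpha>" "0 < s" for \<alpha> s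
    using fp[OF that] pos[OF that] le[OF that] stieltjes_exp_law_bounds[of "s * g \<alpha> s" 0] that
    by (auto simp: abs_mult exp_law.prob_space[simplified] intro!: mult_le_one)
  have "(g \<alpha> \<longlongrightarrow> 1) (at_right 0)" if "0 \<le> \<alpha>" for \<alpha>
  proof -
    have "((\<lambda>s. s * F \<alpha> s) \<longlongrightarrow> 0) (at_right 0)"
    proof (rule tendsto_rabs_zero_cancel, rule tendsto_sandwich[OF _ _ tendsto_const])
      show "\<forall>\<^sub>F s in at_right 0. \<bar>s * F \<alpha> s\<bar> \<le> s"
        using bound[OF that] by (auto intro!: eventually_at_right_0I simp: abs_mult mult_left_le)
    qed (auto intro: tendsto_ident_at)
    then have "((\<lambda>s. 1 - \<alpha> * (s * F \<alpha> s)) \<longlongrightarrow> 1 - \<alpha> * 0) (at_right 0)"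
      by (intro tendsto_intros)
    moreover have "\<forall>\<^sub>F s in at_right 0. 1 - \<alpha> * (s * F \<alpha> s) = g \<alpha> s"
      using g[OF that] by (auto intro!: eventually_at_right_0I simp: mult.assoc)
    ultimately show ?thesis by (simp add: tendsto_cong)
  qed
  then have conv: "limit_family g (\<lambda>_. 1)" by (auto simp: limit_family_def)
  show ?thesis
  proof (induction n)
    case 0
    show ?case by (rule F) (use conv in auto)
  next
    case (Suc n)
    have "expandable n (\<lambda>\<alpha> s. \<alpha> * F \<alpha> s)"
      using Suc by (intro expandable_mult expandable_const tendsto_ident_at)
    then have "expandable n (\<lambda>\<alpha> s. (1 - g \<alpha> s) / s)"
      by (rule expandable_transfer) (simp add: g)
    with conv show ?case by (intro F) auto
  qed
qed

text \<open>
  Each step takes one difference quotient. It turns the expansion of order \<open>n + 1\<close> into one of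
  order \<open>n\<close>, and moves on from the moment of index \<open>m\<close> to the next, whose existence and value come
  from \<open>moment_of_stieltjes_limit\<close>.
\<close>

lemma moment_limits_of_expandable:
  fixes \<nu> :: "real \<Rightarrow> real measure"
  assumes \<nu>: "\<And>\<alpha>. 0 < \<alpha> \<Longrightarrow> sets (\<nu> \<alpha>) = sets borel" "\<And>\<alpha>. 0 < \<alpha> \<Longrightarrow> finite_measure (\<nu> \<alpha>)"
      "\<And>\<alpha>. 0 < \<alpha> \<Longrightarrow> AE t in \<nu> \<alpha>. 0 \<le> t"
    and "expandable n h"
    and "\<And>s. 0 < s \<Longrightarrow> h 0 s = stieltjes exp_law m s"
    and "\<And>\<alpha> s. 0 < \<alpha> \<Longrightarrow> 0 < s \<Longrightarrow> \<alpha> * h \<alpha> s = stieltjes (\<nu> \<alpha>) (Suc m) s"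
    and "\<And>\<alpha> s. 0 < \<alpha> \<Longrightarrow> 0 < s \<Longrightarrow> integrable (\<nu> \<alpha>) (\<lambda>t. t ^ Suc m / (1 + s * t))"
  shows "((\<lambda>\<alpha>. 1 / \<alpha> * (LINT t|\<nu> \<alpha>. t ^ Suc (m + n))) \<longlongrightarrow> (LINT t|exp_law. t ^ (m + n))) (at_right 0)"
  using assms(4-)
proof (induction n arbitrary: h m)
  have key: "integrable (\<nu> \<alpha>) (\<lambda>t. t ^ Suc m) \<and> (LINT t|\<nu> \<alpha>. t ^ Suc m) = \<alpha> * c \<alpha>"
    if "limit_family h c" "0 < \<alpha>" 
      and h: "\<And>\<alpha> s. 0 < \<alpha> \<Longrightarrow> 0 < s \<Longrightarrow> \<alpha> * h \<alpha> s = stieltjes (\<nu> \<alpha>) (Suc m) s"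
      and int: "\<And>\<alpha> s. 0 < \<alpha> \<Longrightarrow> 0 < s \<Longrightarrow> integrable (\<nu> \<alpha>) (\<lambda>t. t ^ Suc m / (1 + s * t))"
    for h c \<alpha> m
  proof -
    have "((\<lambda>s. \<alpha> * h \<alpha> s) \<longlongrightarrow> \<alpha> * c \<alpha>) (at_right 0)"
      using that by (intro tendsto_intros) (auto simp: limit_family_def)
    moreover have "\<forall>\<^sub>F s in at_right 0. \<alpha> * h \<alpha> s = stieltjes (\<nu> \<alpha>) (Suc m) s"
      using h[OF \<open>0 < \<alpha>\<close>] by (auto intro!: eventually_at_right_0I)
    ultimately have "(stieltjes (\<nu> \<alpha>) (Suc m) \<longlongrightarrow> \<alpha> * c \<alpha>) (at_right 0)"
      by (simp add: tendsto_cong)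
    with moment_of_stieltjes_limit[OF \<nu>[OF \<open>0 < \<alpha>\<close>] int[OF \<open>0 < \<alpha>\<close>]] show ?thesis by auto
  qed
  have key0: "(LINT t|exp_law. t ^ m) = c 0"
    if "limit_family h c" and h: "\<And>s. 0 < s \<Longrightarrow> h 0 s = stieltjes exp_law m s" for h c m
  proof -
    have "\<forall>\<^sub>F s in at_right 0. h 0 s = stieltjes exp_law m s"
      using h by (auto intro!: eventually_at_right_0I)
    moreover have "(h 0 \<longlongrightarrow> c 0) (at_right 0)" using that by (simp add: limit_family_def)
    ultimately have "(stieltjes exp_law m \<longlongrightarrow> c 0) (at_right 0)"
      by (simp add: tendsto_cong)
    from tendsto_unique[OF _ stieltjes_exp_law_tendsto this] show ?thesis by simp
  qed
  {
    case 0
    then obtain c where c: "limit_family h c" by auto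
    have "\<forall>\<^sub>F \<alpha> in at_right 0. 1 / \<alpha> * (LINT t|\<nu> \<alpha>. t ^ Suc m) = c \<alpha>"
      using key[OF c _ 0(3,4)] by (auto intro!: eventually_at_right_0I)
    moreover have "(c \<longlongrightarrow> c 0) (at_right 0)" using c by (simp add: limit_family_def)
    ultimately show ?case
      using key0[OF c 0(2)] by (simp add: tendsto_cong)
  next
    case (Suc n)
    then obtain c where c: "limit_family h c" and D: "expandable n (\<lambda>\<alpha> s. (c \<alpha> - h \<alpha> s) / s)" by auto
    have "((\<lambda>\<alpha>. 1 / \<alpha> * (LINT t|\<nu> \<alpha>. t ^ Suc (Suc m + n))) \<longlongrightarrow> (LINT t|exp_law. t ^ (Suc m + n))) (at_right 0)"
    proof (rule Suc.IH[OF D])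
      fix s :: real assume s: "0 < s"
      show "(c 0 - h 0 s) / s = stieltjes exp_law (Suc m) s"
        using key0[OF c Suc.prems(2)] Suc.prems(2)[OF s] stieltjes_exp_law_diff[OF s, of m] by simp
      fix \<alpha> :: real assume \<alpha>: "0 < \<alpha>"
      note k = key[OF c \<alpha> Suc.prems(3,4)]
      have "\<alpha> * ((c \<alpha> - h \<alpha> s) / s) = (\<alpha> * c \<alpha> - \<alpha> * h \<alpha> s) / s"
        by (simp add: field_simps)
      also have "\<dots> = stieltjes (\<nu> \<alpha>) (Suc (Suc m)) s"
        using k stieltjes_diff[OF \<nu>[OF \<alpha>] s, of "Suc m"] Suc.prems(3)[OF \<alpha> s] by simp
      finally show "\<alpha> * ((c \<alpha> - h \<alpha> s) / s) = stieltjes (\<nu> \<alpha>) (Suc (Suc m)) s" .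
      show "integrable (\<nu> \<alpha>) (\<lambda>t. t ^ Suc (Suc m) / (1 + s * t))"
        using integrable_stieltjes_Suc[OF \<nu>[OF \<alpha>] s, of "Suc m"] k by blast
    qed
    then show ?case by simp
  }
qed

text \<open>
  The first difference quotient of \<open>stieltjes (\<nu> \<alpha>) 0\<close>, divided by \<open>\<alpha>\<close>, solves the fixed-point
  equation; at \<open>\<alpha> = 0\<close> its place is taken by the transform of the exponential law.
\<close>

lemma moment_limits_of_stieltjes_equation:
  fixes \<nu> :: "real \<Rightarrow> real measure"
  assumes sets: "\<And>\<alpha>. 0 < \<alpha> \<Longrightarrow> sets (\<nu> \<alpha>) = sets borel"
    and prob: "\<And>\<alpha>. 0 < \<alpha> \<Longrightarrow> prob_space (\<nu> \<alpha>)"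
    and nonneg: "\<And>\<alpha>. 0 < \<alpha> \<Longrightarrow> AE t in \<nu> \<alpha>. 0 \<le> t"
    and eq: "\<And>\<alpha> s. 0 < \<alpha> \<Longrightarrow> 0 < s \<Longrightarrow> 1 - stieltjes (\<nu> \<alpha>) 0 s
      = \<alpha> * s * stieltjes (\<nu> \<alpha>) 0 s * stieltjes exp_law 0 (s * stieltjes (\<nu> \<alpha>) 0 s)"
  shows "((\<lambda>\<alpha>. 1 / \<alpha> * (LINT t|\<nu> \<alpha>. t ^ Suc n)) \<longlongrightarrow> (LINT t|exp_law. t ^ n)) (at_right 0)"
proof -
  have fin: "finite_measure (\<nu> \<alpha>)" if "0 < \<alpha>" for \<alpha>
    using prob[OF that] by (rule prob_space.finite_measure)
  have one: "(LINT t|\<nu> \<alpha>. t ^ 0) = 1" if "0 < \<alpha>" for \<alpha>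
    using prob_space.prob_space[OF prob[OF that]] by simp
  have st0: "integrable (\<nu> \<alpha>) (\<lambda>t. t ^ 0)" if "0 < \<alpha>" for \<alpha>
    using fin[OF that] by (simp add: finite_measure.integrable_const)
  define F where "F \<alpha> s = (if \<alpha> = 0 then stieltjes exp_law 0 s else stieltjes (\<nu> \<alpha>) 1 s / \<alpha>)" for \<alpha> s
  define g where "g \<alpha> s = (if \<alpha> = 0 then 1 else stieltjes (\<nu> \<alpha>) 0 s)" for \<alpha> s
  have diff: "(1 - stieltjes (\<nu> \<alpha>) 0 s) / s = stieltjes (\<nu> \<alpha>) 1 s" if "0 < \<alpha>" "0 < s" for \<alpha> s
    using stieltjes_diff[OF sets fin nonneg \<open>0 < s\<close> st0] that one by simp
  have ge: "0 \<le> stieltjes (\<nu> \<alpha>) 0 s" if "0 < \<alpha>" "0 < s" for \<alpha> s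
    unfolding stieltjes_def using nonneg[OF that(1)] that
    by (intro integral_nonneg_AE) (auto elim!: eventually_mono simp: add_nonneg_nonneg)
  have "expandable n F"
  proof (rule expandable_fixed_point)
    fix \<alpha> s :: real assume \<alpha>: "0 \<le> \<alpha>" and s: "0 < s"
    show "F \<alpha> s = g \<alpha> s * stieltjes exp_law 0 (s * g \<alpha> s)"
      using diff[OF _ s, of \<alpha>] eq[OF _ s, of \<alpha>] \<alpha> s by (auto simp: F_def g_def field_simps)
    show "g \<alpha> s = 1 - \<alpha> * s * F \<alpha> s"
      using diff[OF _ s, of \<alpha>] \<alpha> s by (auto simp: F_def g_def field_simps)
    show "0 < g \<alpha> s"
    proof (cases "\<alpha> = 0")
      case False
      then have "stieltjes (\<nu> \<alpha>) 0 s \<noteq> 0" using eq[OF _ s, of \<alpha>] \<alpha> by auto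
      with False ge[OF _ s, of \<alpha>] \<alpha> show ?thesis by (simp add: g_def)
    qed (simp add: g_def)
    show "g \<alpha> s \<le> 1"
    proof (cases "\<alpha> = 0")
      case False
      then have "0 \<le> 1 - stieltjes (\<nu> \<alpha>) 0 s"
        using \<alpha> s ge[of \<alpha> s] eq[of \<alpha> s]
          stieltjes_exp_law_bounds(1)[of "s * stieltjes (\<nu> \<alpha>) 0 s" 0] by simp
      with False show ?thesis by (simp add: g_def)
    qed (simp add: g_def)
  qed
  have "((\<lambda>\<alpha>. 1 / \<alpha> * (LINT t|\<nu> \<alpha>. t ^ Suc (0 + n))) \<longlongrightarrow> (LINT t|exp_law. t ^ (0 + n))) (at_right 0)"
  proof (rule moment_limits_of_expandable[OF sets fin nonneg \<open>expandable n F\<close>])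
    show "integrable (\<nu> \<alpha>) (\<lambda>t. t ^ Suc 0 / (1 + s * t))" if "0 < \<alpha>" "0 < s" for \<alpha> s
      by (rule integrable_stieltjes_Suc[OF sets fin nonneg _ st0]) (use that in auto)
  qed (auto simp: F_def)
  then show ?thesis by simp
qed

section \<open>Convergence of the moments\<close>

theorem proposition6p1:
  fixes \<nu> :: "real \<Rightarrow> real measure" and p :: nat
  assumes "\<And>\<alpha>. 0 < \<alpha> \<Longrightarrow> free_gamma \<alpha> (\<nu> \<alpha>)"
    and "1 \<le> p"
  shows "((\<lambda>\<alpha>. 1 / \<alpha> * (LINT t:{0..}|\<nu> \<alpha>. t ^ p)) \<longlongrightarrow>
           (LINT t:{0..}|lborel. t ^ (p - 1) * exp (- t))) (at_right 0)"
proof -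
  note fg = assms(1)
  obtain n where p: "p = Suc n" using assms(2) by (cases p) auto
  have rd: "real_distribution (\<nu> \<alpha>)" if "0 < \<alpha>" for \<alpha>
    using fg[OF that]
    by (auto simp: free_gamma_def bercovici_pata_def free_characteristic_triplet_def)
  then have prob: "prob_space (\<nu> \<alpha>)" and sets: "sets (\<nu> \<alpha>) = sets borel" if "0 < \<alpha>" for \<alpha>
    using that by (simp_all add: real_distribution_def real_distribution_axioms_def)
  have lim: "((\<lambda>\<alpha>. 1 / \<alpha> * (LINT t|\<nu> \<alpha>. t ^ Suc n)) \<longlongrightarrow> (LINT t|exp_law. t ^ n)) (at_right 0)"
    using prob sets free_gamma_nonneg[OF _ fg] free_gamma_K_inverts_cauchy_transform[OF _ fg]
    by (intro moment_limits_of_stieltjes_equation stieltjes_equation)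
  have "(LINT t:{0..}|\<nu> \<alpha>. t ^ p) = (LINT t|\<nu> \<alpha>. t ^ Suc n)" if "0 < \<alpha>" for \<alpha>
    unfolding set_lebesgue_integral_def
  proof (rule integral_cong_AE)
    note [measurable_cong] = sets[OF that]
    show "(\<lambda>t. indicator {0..} t *\<^sub>R t ^ p) \<in> borel_measurable (\<nu> \<alpha>)"
      "(\<lambda>t. t ^ Suc n) \<in> borel_measurable (\<nu> \<alpha>)" by measurable
    show "AE t in \<nu> \<alpha>. indicator {0..} t *\<^sub>R t ^ p = t ^ Suc n"
      using free_gamma_nonneg[OF that fg[OF that]] by eventually_elim (simp add: p)
  qed
  then have "\<forall>\<^sub>F \<alpha> in at_right 0.
      1 / \<alpha> * (LINT t|\<nu> \<alpha>. t ^ Suc n) = 1 / \<alpha> * (LINT t:{0..}|\<nu> \<alpha>. t ^ p)"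
    by (intro eventually_at_right_0I) simp
  with lim have "((\<lambda>\<alpha>. 1 / \<alpha> * (LINT t:{0..}|\<nu> \<alpha>. t ^ p)) \<longlongrightarrow> (LINT t|exp_law. t ^ n)) (at_right 0)"
    by (rule Lim_transform_eventually)
  also have "(LINT t|exp_law. t ^ n) = (LINT t:{0<..}|lborel. exp (- t) *\<^sub>R t ^ n)"
    by (rule integral_exp_law_eq) simp
  also have "\<dots> = (LINT t:{0..}|lborel. t ^ (p - 1) * exp (- t))"
    unfolding set_lebesgue_integral_def
  proof (rule integral_cong_AE)
    show "AE t in lborel. indicator {0<..} t *\<^sub>R exp (- t) *\<^sub>R t ^ n
        = indicator {0..} t *\<^sub>R (t ^ (p - 1) * exp (- t))"
      using AE_lborel_singleton[of "0::real"]
      by eventually_elim (auto simp: p indicator_def)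
  qed measurable
  finally show ?thesis .
qed

end
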